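(* Let $\mathcal{R}_{\text{UH}}$ be the range family of all unit-height axis-aligned rectangles in $\mathbb{R}^2$ and let $m$ be a positive integer. Then, for every finite point set $V \subset \mathbb{R}^2$ in general position, the hypergraph $\mathcal{H}(V, \mathcal{R}_{\text{UH}}, m)$ admits a $63$-shallow hitting set $X \subseteq V$. Moreover, for every positive integer $k$, $$m_{\mathcal{R}_{\text{UH}}}(k) \;\leq\; 2\,m_{\mathcal{R}_{\text{BL}}\cup\mathcal{R}_{\text{TL}}}(k)-1 \;\leq\; 12k - 7 .$$
   Context: The family of all unit-height rectangles is $\mathcal{R}_{\text{UH}} = \{ [a,b] \times [c,c+1] \mid a,b,c \in \mathbb{R} \}$, the family of all bottomless rectangles is $\mathcal{R}_{\text{BL}} = \{ [a,b] \times (-\infty,c] \mid a,b,c \in \mathbb{R} \}$ and the family of all topless rectangles is $\mathcal{R}_{\text{TL}} = \{ [a,b] \times [c,\infty) \mid a,b,c \in \mathbb{R} \}$. For a range family $\mathcal{R}$ (a family of subsets of $\mathbb{R}^2$), a finite point set $V \subset \mathbb{R}^2$ and a positive integer $m$, $\mathcal{H}(V,\mathcal{R},m)$ is the hypergraph with vertex set $V$ whose hyperedges are exactly the subsets $e \subseteq V$ with $|e| = m$ for which there is some $R \in \mathcal{R}$ with $e = V \cap R$. General position means that distinct points of $V$ have different $x$-coordinates and different $y$-coordinates. For a hypergraph with vertex set $V$ and hyperedge set $E$ and a positive integer $t$, a $t$-shallow hitting set is a subset $X \subseteq V$ with $1 \leq |e \cap X| \leq t$ for every $e \in E$. A polychromatic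 $k$-coloring of a hypergraph is a map from its vertices to $\{1,\ldots,k\}$ such that every hyperedge contains vertices of all $k$ colors. The quantity $m_{\mathcal{R}}(k)$ is the smallest positive integer $m$ (or $\infty$ if none exists) such that for every finite $V \subset \mathbb{R}^2$ in general position the hypergraph $\mathcal{H}(V,\mathcal{R},m)$ has a polychromatic $k$-coloring. *)

theory Defs
  imports Complex_Main "HOL-Library.Extended_Nat"
begin

type_synonym point = "real \<times> real"

text \<open>A hypergraph is a pair of a vertex set and a set of hyperedges.\<close>

type_synonym 'a hypergraph = "'a set \<times> 'a set set"

definition unit_height_rectangles :: "point set set" where
  "unit_height_rectangles = {{a..b} \<times> {c..c + 1} | a b c. True}"

definition bottomless_rectangles :: "point set set" where
  "bottomless_rectangles = {{a..b} \<times> {..c} | a b c. True}"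

definition topless_rectangles :: "point set set" where
  "topless_rectangles = {{a..b} \<times> {c..} | a b c. True}"

definition general_position :: "point set \<Rightarrow> bool" where
  "general_position V \<longleftrightarrow>
     (\<forall>p\<in>V. \<forall>q\<in>V. p \<noteq> q \<longrightarrow> fst p \<noteq> fst q \<and> snd p \<noteq> snd q)"

definition range_hypergraph :: "point set \<Rightarrow> point set set \<Rightarrow> nat \<Rightarrow> point hypergraph" where
  "range_hypergraph V \<R> m = (V, {e. e \<subseteq> V \<and> card e = m \<and> (\<exists>R\<in>\<R>. e = V \<inter> R)})"

definition shallow_hitting_set :: "nat \<Rightarrow> 'a hypergraph \<Rightarrow> 'a set \<Rightarrow> bool" where
  "shallow_hitting_set t H X \<longleftrightarrow>
     X \<subseteq> fst H \<and> (\<forall>e\<in>snd H. 1 \<le> card (e \<inter> X) \<and> card (e \<inter> X) \<le> t)"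

definition polychromatic_coloring :: "nat \<Rightarrow> 'a hypergraph \<Rightarrow> ('a \<Rightarrow> nat) \<Rightarrow> bool" where
  "polychromatic_coloring k H c \<longleftrightarrow>
     c ` fst H \<subseteq> {1..k} \<and> (\<forall>e\<in>snd H. \<forall>i\<in>{1..k}. \<exists>v\<in>e. c v = i)"

text \<open>The infimum is taken in \<^typ>\<open>enat\<close>: it is attained when the set is nonempty, and it
  is \<open>\<infinity>\<close> when the set is empty.\<close>

definition polychromatic_number :: "point set set \<Rightarrow> nat \<Rightarrow> enat" where
  "polychromatic_number \<R> k =
     Inf {enat m | m. 0 < m \<and>
       (\<forall>V. finite V \<and> general_position V \<longrightarrow>
          (\<exists>c. polychromatic_coloring k (range_hypergraph V \<R> m) c))}"

end

theory Submission
  imports Defs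
begin

text \<open>
  Cut the plane into the horizontal strips of points \<open>p\<close> with \<open>\<lfloor>snd p\<rfloor> = i\<close>. A rectangle of unit height
  meets at most two consecutive strips. Inside the lower one it looks like a topless rectangle, inside
  the upper one like a bottomless rectangle, and one of the two parts holds at least half of its points.
  So it suffices to treat each strip separately, and there the bottomless and the topless ranges
  simultaneously (\<open>card_unit_height_split\<close>, \<open>unit_height_coloring\<close>, \<open>unit_height_shallow\<close>).

  Colourings. For bottomless ranges alone, \<open>3 * k - 2\<close> points suffice (\<open>bottomless_coloring\<close>). Insert
  the points from bottom to top and keep a partial colouring in which equally coloured points have at
  least \<open>k - 1\<close> points between them. When some interval of \<open>3 * k - 2\<close> consecutive points misses a
  colour, its \<open>k\<close> middle points carry at most \<open>k - 1\<close> colours, each at most once, so that one of them is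
  uncoloured and can take the missing colour. To serve topless ranges as well, pair the points that
  are neighbours in the order by \<open>x\<close>, and let \<open>R\<close> consist of the lower point of each pair. A bottomless
  range that contains the upper point of a pair also contains the lower one, except in the at most
  two pairs that its vertical sides cut apart (\<open>balanced_halves\<close>). Hence a bottomless range with
  \<open>6 * k - 3\<close> points has at least \<open>3 * k - 2\<close> of them in \<open>R\<close>, a topless one has as many outside \<open>R\<close>, and the
  two parts are coloured independently. This gives the bound \<open>2 * (6 * k - 3) - 1 = 12 * k - 7\<close>.

  Hitting sets. Fix \<open>s\<close> and sweep a strip from bottom to top, maintaining a partition of the points
  seen so far into \<^emph>\<open>blocks\<close>, which are intervals in the order by \<open>x\<close>. A block that reaches \<open>2 * s\<close> points is
  split into two blocks of \<open>s\<close> points each. As long as all blocks have less than \<open>2 * s\<close> points, an interval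
  of \<open>4 * s - 3\<close> points contains a whole block, so it is enough to hit the \<open>s\<close> points that each block has
  at its birth. The blocks that are never split, the \<^emph>\<open>leaves\<close>, partition the strip, and every leaf
  contributes exactly one point to the hitting set. By default it is the \<^emph>\<open>median\<close>, which lies halfway
  up among the \<open>s\<close> lowest points of the leaf. If the birth set of a block contains neither a
  median nor an earlier pick, a point of it is \<^emph>\<open>picked\<close> that was not present when the parent of the block
  was born; it replaces the median of its leaf (\<open>picks_exist\<close>). In this way
  every birth set contains at most one pick, and every block contains at most two as long as it is not split.
  Picks lie below the medians of their leaves, which has two consequences. A range that is hit by a
  replaced median is also hit by the pick that replaces it. And a topless range can only contain the
  chosen point of a leaf that it does not cut apart if it contains at least \<open>(s + 1) / 2\<close> points of that leaf, so
  that the points chosen for the bottomless ranges are sparse in the topless ranges too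
  (\<open>bottomless_transversal\<close>).

  The number 63 arises as follows. Take \<open>s\<close> such that half of the \<open>m\<close> points are at least \<open>4 * s - 3\<close>, while
  \<open>m \<le> 8 * s\<close>. In the two strips that a rectangle meets, the points that were chosen for its own kind of
  range number at most \<open>(4 * m + 12 * s) / s \<le> 44\<close>. Those chosen for the other kind number at
  most \<open>(2 * m + 4 * (s + 1)) / (s + 1) < 20\<close>.
\<close>

section \<open>Lowest points and lower parts\<close>

text \<open>When \<open>f\<close> is injective on a finite set \<open>A\<close>, this is the set of the \<open>n\<close> elements of \<open>A\<close> with the least
  values of \<open>f\<close> (\<open>card_lowest\<close>). The functions \<open>fst\<close> and \<open>snd\<close> both serve as \<open>f\<close>.\<close>

definition lowest :: "('a \<Rightarrow> real) \<Rightarrow> nat \<Rightarrow> 'a set \<Rightarrow> 'a set" where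
  "lowest f n A = {p \<in> A. card {q \<in> A. f q < f p} < n}"

definition lower_part :: "('a \<Rightarrow> real) \<Rightarrow> 'a set \<Rightarrow> 'a set \<Rightarrow> bool" where
  "lower_part f D A \<longleftrightarrow> D \<subseteq> A \<and> (\<forall>p\<in>D. \<forall>q\<in>A. f q \<le> f p \<longrightarrow> q \<in> D)"

lemma lowest_subset: "lowest f n A \<subseteq> A"
  by (auto simp: lowest_def)

lemma lower_part_lowest:
  assumes "finite A"
  shows "lower_part f (lowest f n A) A"
  unfolding lower_part_def
proof (intro conjI ballI impI)
  show "lowest f n A \<subseteq> A" by (rule lowest_subset)
  fix p q assume p: "p \<in> lowest f n A" and q: "q \<in> A" "f q \<le> f p"
  have "card {r \<in> A. f r < f q} \<le> card {r \<in> A. f r < f p}"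
    using q assms by (intro card_mono) auto
  then show "q \<in> lowest f n A"
    using p q by (auto simp: lowest_def)
qed

lemma lower_part_mono:
  "lower_part f D A \<Longrightarrow> B \<subseteq> A \<Longrightarrow> lower_part f (D \<inter> B) B"
  unfolding lower_part_def by blast

lemma lower_part_below: "lower_part f {p \<in> A. f p \<le> c} A"
  by (auto simp: lower_part_def)

text \<open>The lower parts of a set form a chain, since they are its initial segments in the order by \<open>f\<close>.
  Therefore cardinalities decide which of two lower parts contains the other, as in this lemma and
  the next one.\<close>

lemma lowest_subset_lower_part:
  assumes "finite A" "lower_part f D A" "n \<le> card D"
  shows "lowest f n A \<subseteq> D"
proof
  fix p assume p: "p \<in> lowest f n A"
  show "p \<in> D"
  proof (rule ccontr)
    assume np: "p \<notin> D"
    have "p \<in> A" using p by (auto simp: lowest_def)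
    then have "D \<subseteq> {q \<in> A. f q < f p}"
      using np assms(2) unfolding lower_part_def by force
    then have "card D \<le> card {q \<in> A. f q < f p}"
      using assms(1) by (intro card_mono) auto
    then show False using p assms(3) by (auto simp: lowest_def)
  qed
qed

lemma lower_part_subset_lowest:
  assumes "finite A" "lower_part f D A" "card D \<le> n"
  shows "D \<subseteq> lowest f n A"
proof
  fix p assume p: "p \<in> D"
  have D: "D \<subseteq> A" using assms(2) by (auto simp: lower_part_def)
  have fin: "finite D" using D assms(1) finite_subset by blast
  have "{q \<in> A. f q < f p} \<subseteq> D - {p}"
    using p assms(2) unfolding lower_part_def by fastforce
  then have "card {q \<in> A. f q < f p} \<le> card (D - {p})"
    using fin by (intro card_mono) auto
  also have "\<dots> < card D" using p fin by (intro psubset_card_mono) auto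
  finally show "p \<in> lowest f n A"
    using p D assms(3) by (auto simp: lowest_def)
qed

lemma card_lowest:
  assumes "finite A" "inj_on f A"
  shows "card (lowest f n A) = min n (card A)"
proof -
  define r where "r p = card {q \<in> A. f q < f p}" for p
  have less: "r p < r q" if "p \<in> A" "q \<in> A" "f p < f q" for p q
    unfolding r_def using that assms(1) by (intro psubset_card_mono) auto
  have inj: "inj_on r A"
  proof (rule inj_onI)
    fix p q assume "p \<in> A" "q \<in> A" "r p = r q"
    then show "p = q"
      using less[of p q] less[of q p] assms(2)
      by (metis inj_on_def less_irrefl linorder_neqE_linordered_idom)
  qed
  have "r ` A \<subseteq> {..<card A}"
    unfolding r_def using assms(1) by (auto intro!: psubset_card_mono)
  then have im: "r ` A = {..<card A}"
    using card_image[OF inj] by (intro card_subset_eq) auto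
  have "r ` lowest f n A = {..<min n (card A)}"
  proof -
    have "lowest f n A = {p \<in> A. r p < n}" by (auto simp: lowest_def r_def)
    then have "r ` lowest f n A = r ` A \<inter> {..<n}" by auto
    then show ?thesis using im by (auto simp: set_eq_iff)
  qed
  moreover have "inj_on r (lowest f n A)"
    by (rule inj_on_subset[OF inj lowest_subset])
  ultimately show ?thesis
    using card_image[of r "lowest f n A"] by simp
qed

lemma lowest_eq:
  assumes "finite A" "inj_on f A" "lower_part f D A" "card D = n"
  shows "lowest f n A = D"
  using lowest_subset_lower_part[OF assms(1,3)] lower_part_subset_lowest[OF assms(1,3)] assms(4)
  by (intro equalityI) auto

section \<open>Families of point sets ordered from left to right\<close>

definition left_of :: "point set \<Rightarrow> point set \<Rightarrow> bool" where
  "left_of A B \<longleftrightarrow> (\<forall>p\<in>A. \<forall>q\<in>B. fst p < fst q)"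

definition separated :: "point set set \<Rightarrow> bool" where
  "separated \<A> \<longleftrightarrow> pairwise (\<lambda>A B. left_of A B \<or> left_of B A) \<A>"

definition cut_by :: "real \<Rightarrow> real \<Rightarrow> point set set \<Rightarrow> point set set" where
  "cut_by a b \<A> = {A \<in> \<A>. (\<exists>p\<in>A. fst p \<in> {a..b}) \<and> (\<exists>p\<in>A. fst p \<notin> {a..b})}"

lemma separated_disjoint:
  "separated \<A> \<Longrightarrow> A \<in> \<A> \<Longrightarrow> B \<in> \<A> \<Longrightarrow> p \<in> A \<Longrightarrow> p \<in> B \<Longrightarrow> A = B"
  unfolding separated_def left_of_def pairwise_def by force

lemma separated_straddle:
  assumes sep: "separated \<A>" and S: "\<And>x y. x \<in> S \<Longrightarrow> y \<notin> S \<Longrightarrow> x < (y :: real)"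
    and A: "A \<in> \<A>" "p \<in> A" "fst p \<in> S" "p' \<in> A" "fst p' \<notin> S"
    and B: "B \<in> \<A>" "q \<in> B" "fst q \<in> S" "q' \<in> B" "fst q' \<notin> S"
  shows "A = B"
proof (rule ccontr)
  assume "A \<noteq> B"
  then have "left_of A B \<or> left_of B A"
    using sep A(1) B(1) by (auto simp: separated_def pairwise_def)
  then have "fst p' < fst q \<or> fst q' < fst p"
    using A B unfolding left_of_def by blast
  moreover have "fst q < fst p'" "fst p < fst q'" using S A B by auto
  ultimately show False by linarith
qed

text \<open>For an initial segment \<open>S\<close> of the real line, think of its right end as a vertical line. Of two
  members of a separated family one lies to the left of the other, so that at most one member has
  points on both sides of the line.\<close>

lemma card_straddle:
  assumes sep: "separated \<A>" and S: "\<And>x y. x \<in> S \<Longrightarrow> y \<notin> S \<Longrightarrow> x < (y :: real)" and fin: "finite \<A>"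
  shows "card {A \<in> \<A>. (\<exists>p\<in>A. fst p \<in> S) \<and> (\<exists>p\<in>A. fst p \<notin> S)} \<le> Suc 0"
  (is "card ?C \<le> _")
proof -
  have "\<forall>A\<in>?C. \<forall>B\<in>?C. A = B"
  proof (intro ballI)
    fix A B assume A: "A \<in> ?C" and B: "B \<in> ?C"
    obtain p p' where p: "A \<in> \<A>" "p \<in> A" "fst p \<in> S" "p' \<in> A" "fst p' \<notin> S"
      using A by blast
    obtain q q' where q: "B \<in> \<A>" "q \<in> B" "fst q \<in> S" "q' \<in> B" "fst q' \<notin> S"
      using B by blast
    show "A = B" by (rule separated_straddle[OF sep S p q])
  qed
  moreover have "finite ?C" using fin by simp
  ultimately show ?thesis by (intro iffD2[OF card_le_Suc0_iff_eq])
qed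

text \<open>A member that meets the slab between \<open>a\<close> and \<open>b\<close> without being contained in it straddles one of
  the two sides of the slab.\<close>

lemma card_cut_by:
  assumes "separated \<A>" "finite \<A>"
  shows "card (cut_by a b \<A>) \<le> 2"
proof -
  let ?C = "\<lambda>S. {A \<in> \<A>. (\<exists>p\<in>A. fst p \<in> S) \<and> (\<exists>p\<in>A. fst p \<notin> S)}"
  have 1: "card (?C {..<a}) \<le> Suc 0"
    by (rule card_straddle[OF assms(1) _ assms(2)]) auto
  have 2: "card (?C {..b}) \<le> Suc 0"
    by (rule card_straddle[OF assms(1) _ assms(2)]) auto
  have "cut_by a b \<A> \<subseteq> ?C {..<a} \<union> ?C {..b}"
  proof
    fix A assume "A \<in> cut_by a b \<A>"
    then obtain p q where "A \<in> \<A>" "p \<in> A" "a \<le> fst p" "fst p \<le> b" "q \<in> A" "fst q < a \<or> b < fst q"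
      unfolding cut_by_def by (auto simp: not_le)
    moreover from this have "fst p \<notin> {..<a}" "fst p \<in> {..b}" "fst q \<in> {..<a} \<or> fst q \<notin> {..b}"
      by auto
    ultimately show "A \<in> ?C {..<a} \<union> ?C {..b}" by blast
  qed
  then have "card (cut_by a b \<A>) \<le> card (?C {..<a} \<union> ?C {..b})"
    using assms(2) by (intro card_mono) auto
  moreover have "card (?C {..<a} \<union> ?C {..b}) \<le> card (?C {..<a}) + card (?C {..b})"
    by (rule card_Un_le)
  ultimately show ?thesis using 1 2 by linarith
qed

lemma separated_refine:
  assumes "separated \<A>"
  shows "separated ((\<lambda>A. A \<inter> B) ` \<A>)"
  unfolding separated_def pairwise_def
proof (intro ballI impI)
  fix A' C' assume "A' \<in> (\<lambda>A. A \<inter> B) ` \<A>" "C' \<in> (\<lambda>A. A \<inter> B) ` \<A>" "A' \<noteq> C'"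
  then obtain A C where AC: "A \<in> \<A>" "C \<in> \<A>" "A' = A \<inter> B" "C' = C \<inter> B" "A \<noteq> C" by blast
  then have "left_of A C \<or> left_of C A" using assms by (auto simp: separated_def pairwise_def)
  then show "left_of A' C' \<or> left_of C' A'" unfolding AC left_of_def by blast
qed

lemma separated_Un:
  assumes "separated \<A>" "separated \<B>" "left_of (\<Union>\<A>) (\<Union>\<B>)"
  shows "separated (\<A> \<union> \<B>)"
  unfolding separated_def pairwise_def
proof (intro ballI impI)
  fix A B assume "A \<in> \<A> \<union> \<B>" "B \<in> \<A> \<union> \<B>" "A \<noteq> B"
  moreover have "left_of A' B'" if "A' \<in> \<A>" "B' \<in> \<B>" for A' B'
    using that assms(3) unfolding left_of_def by blast
  ultimately show "left_of A B \<or> left_of B A"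
    using assms(1,2) unfolding separated_def pairwise_def by blast
qed

section \<open>Block trees\<close>

text \<open>The tree of blocks that arises in the upward sweep. Here a block is identified with the set of
  \<^emph>\<open>all\<close> points in its vertical slab, including those that the sweep meets after its birth or even after
  it has been split. Then the points that are present at its birth are the \<open>s\<close> lowest ones, and those present
  when it is split are the \<open>2 * s\<close> lowest ones, so the tree can be described without reference to time. The
  arguments are the parameter \<open>s\<close>, the root block, the set of leaves and the set of all blocks.\<close>

inductive block_tree :: "nat \<Rightarrow> point set \<Rightarrow> point set set \<Rightarrow> point set set \<Rightarrow> bool" for s where
  leaf: "finite A \<Longrightarrow> s \<le> card A \<Longrightarrow> card A < 2 * s \<Longrightarrow> block_tree s A {A} {A}"
| split: "block_tree s W\<^sub>1 \<L>\<^sub>1 \<B>\<^sub>1 \<Longrightarrow> block_tree s W\<^sub>2 \<L>\<^sub>2 \<B>\<^sub>2 \<Longrightarrow> left_of W\<^sub>1 W\<^sub>2 \<Longrightarrow>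
    lowest snd (2 * s) (W\<^sub>1 \<union> W\<^sub>2) = lowest snd s W\<^sub>1 \<union> lowest snd s W\<^sub>2 \<Longrightarrow>
    block_tree s (W\<^sub>1 \<union> W\<^sub>2) (\<L>\<^sub>1 \<union> \<L>\<^sub>2) (insert (W\<^sub>1 \<union> W\<^sub>2) (\<B>\<^sub>1 \<union> \<B>\<^sub>2))"

lemma left_of_disjoint: "left_of A B \<Longrightarrow> A \<inter> B = {}"
  by (force simp: left_of_def)

text \<open>A set \<open>W\<close> with at least \<open>2 * s\<close> points is split by a vertical line that halves its \<open>2 * s\<close> lowest points.
  The line need not halve \<open>W\<close> itself.\<close>

lemma block_tree_exists:
  assumes "finite W" "inj_on fst W" "inj_on snd W" "0 < s" "s \<le> card W"
  shows "\<exists>\<L> \<B>. block_tree s W \<L> \<B>"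
  using assms
proof (induction "card W" arbitrary: W rule: less_induct)
  case less
  show ?case
  proof (cases "card W < 2 * s")
    case True
    then show ?thesis using less.prems block_tree.leaf by blast
  next
    case False
    define D where "D = lowest snd (2 * s) W"
    have D: "card D = 2 * s" "D \<subseteq> W" "lower_part snd D W"
      using False less.prems card_lowest[of W snd "2 * s"] lower_part_lowest[of W snd]
      by (auto simp: D_def lowest_subset)
    have fD: "finite D" using D(2) less.prems(1) by (rule finite_subset)
    define L where "L = lowest fst s D"
    have L: "card L = s" "L \<subseteq> D" "lower_part fst L D"
      using D fD card_lowest[of D fst s] inj_on_subset[OF less.prems(2) D(2)]
        lower_part_lowest[of D fst] by (auto simp: L_def lowest_subset)
    define W1 where "W1 = {p \<in> W. \<exists>q\<in>L. fst p \<le> fst q}"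
    define W2 where "W2 = W - W1"
    have DW1: "D \<inter> W1 = L"
      using L D(2) unfolding W1_def lower_part_def by blast
    have DW2: "D \<inter> W2 = D - L"
      using DW1 D(2) unfolding W2_def by blast
    have card2: "card (D - L) = s"
      using L D fD by (simp add: card_Diff_subset finite_subset)
    have low: "lowest snd s V = D \<inter> V" if "V \<subseteq> W" "card (D \<inter> V) = s" for V
      using that less.prems lower_part_mono[OF D(3)]
      by (intro lowest_eq) (auto intro: finite_subset inj_on_subset)
    have l1: "lowest snd s W1 = L" and l2: "lowest snd s W2 = D - L"
      using low[of W1] low[of W2] DW1 DW2 L card2 by (auto simp: W1_def W2_def)
    have ne: "L \<noteq> {}" "D - L \<noteq> {}" using L card2 \<open>0 < s\<close> by auto
    have sub: "W1 \<subseteq> W" "W2 \<subseteq> W" "W = W1 \<union> W2" "W1 \<inter> W2 = {}" by (auto simp: W1_def W2_def)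
    have fin: "finite W1" "finite W2" using sub less.prems(1) finite_subset by blast+
    have "L \<subseteq> W1" "D - L \<subseteq> W2" using DW1 DW2 by blast+
    then have c: "s \<le> card W1" "s \<le> card W2"
      using L(1) card2 fin card_mono by metis+
    have "W1 \<subset> W" "W2 \<subset> W" using sub ne \<open>L \<subseteq> W1\<close> \<open>D - L \<subseteq> W2\<close> by blast+
    then have "card W1 < card W" "card W2 < card W"
      using less.prems(1) psubset_card_mono by blast+
    then obtain L1 B1 L2 B2 where "block_tree s W1 L1 B1" "block_tree s W2 L2 B2"
      using less.hyps[of W1] less.hyps[of W2] c fin less.prems sub inj_on_subset by metis
    moreover have "left_of W1 W2"
      unfolding left_of_def W1_def W2_def by force
    moreover have "lowest snd (2 * s) (W1 \<union> W2) = lowest snd s W1 \<union> lowest snd s W2"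
      using l1 l2 L(2) D_def sub(3) by auto
    ultimately show ?thesis using block_tree.split sub(3) by metis
  qed
qed

lemma block_tree_finite: "block_tree s W \<L> \<B> \<Longrightarrow> finite W"
  by (induction rule: block_tree.induct) auto

lemma block_tree_card: "block_tree s W \<L> \<B> \<Longrightarrow> s \<le> card W"
proof (induction rule: block_tree.induct)
  case (split W1 L1 B1 W2 L2 B2)
  have "card W1 \<le> card (W1 \<union> W2)"
    using split block_tree_finite by (intro card_mono) auto
  then show ?case using split by linarith
qed

lemma block_tree_leaves:
  assumes "block_tree s W \<L> \<B>"
  shows "\<Union>\<L> = W" "separated \<L>" "\<And>L. L \<in> \<L> \<Longrightarrow> s \<le> card L"
  using assms
proof (induction rule: block_tree.induct)
  case (leaf A)
  { case 1 then show ?case by simp next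
    case 2 then show ?case by (simp add: separated_def) next
    case 3 then show ?case using leaf by simp }
next
  case (split W1 L1 B1 W2 L2 B2)
  { case 1 then show ?case using split by auto next
    case 2 then show ?case using split by (intro separated_Un) auto next
    case 3 then show ?case using split by auto }
qed

lemma block_tree_blocks_subset: "block_tree s W \<L> \<B> \<Longrightarrow> A \<in> \<B> \<Longrightarrow> A \<subseteq> W"
  by (induction rule: block_tree.induct) auto

lemma block_tree_leaf_in_block:
  assumes "block_tree s W \<L> \<B>" "A \<in> \<B>" "L \<in> \<L>" "L \<inter> A \<noteq> {}"
  shows "L \<subseteq> A"
  using assms
proof (induction arbitrary: A L rule: block_tree.induct)
  case (leaf A)
  then show ?case by auto
next
  case (split W1 L1 B1 W2 L2 B2)
  have d: "W1 \<inter> W2 = {}" using split.hyps(3) by (rule left_of_disjoint)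
  have s: "L \<subseteq> W1" if "L \<in> L1" for L using that block_tree_leaves(1)[OF split.hyps(1)] by blast
  have t: "L \<subseteq> W2" if "L \<in> L2" for L using that block_tree_leaves(1)[OF split.hyps(2)] by blast
  have b: "A \<subseteq> W1" if "A \<in> B1" for A using that block_tree_blocks_subset[OF split.hyps(1)] by blast
  have c: "A \<subseteq> W2" if "A \<in> B2" for A using that block_tree_blocks_subset[OF split.hyps(2)] by blast
  consider "A = W1 \<union> W2" | "A \<in> B1" "L \<in> L1" | "A \<in> B1" "L \<in> L2" | "A \<in> B2" "L \<in> L1" | "A \<in> B2" "L \<in> L2"
    using split.prems by blast
  then show ?case
  proof cases
    case 1 then show ?thesis using split.prems(2) s t by blast
  next
    case 2 then show ?thesis using split.IH(1) split.prems(3) by blast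
  next
    case 3 then show ?thesis using split.prems(3) b[of A] t[of L] d by blast
  next
    case 4 then show ?thesis using split.prems(3) c[of A] s[of L] d by blast
  next
    case 5 then show ?thesis using split.IH(2) split.prems(3) by blast
  qed
qed

text \<open>The frontier consists of the blocks that are alive when the sweep has reached height \<open>c\<close>: those
  born by then but not yet split. The lower bound fails only while the root itself has not been born.\<close>

lemma block_tree_frontier:
  assumes "block_tree s W \<L> \<B>" "inj_on snd W"
  shows "\<exists>\<F> \<subseteq> \<B>. separated \<F> \<and> \<Union>\<F> = W \<and> (\<forall>A\<in>\<F>. card {p \<in> A. snd p \<le> c} < 2 * s \<and>
    (s \<le> card {p \<in> W. snd p \<le> c} \<longrightarrow> s \<le> card {p \<in> A. snd p \<le> c}))"
  using assms
proof (induction rule: block_tree.induct)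
  case (leaf A)
  have "card {p \<in> A. snd p \<le> c} \<le> card A" using leaf by (intro card_mono) auto
  then show ?case using leaf by (intro exI[of _ "{A}"]) (auto simp: separated_def)
next
  case (split W1 L1 B1 W2 L2 B2)
  let ?c = "\<lambda>A. {p \<in> A. snd p \<le> c}"
  show ?case
  proof (cases "card (?c (W1 \<union> W2)) < 2 * s")
    case True
    then show ?thesis by (intro exI[of _ "{W1 \<union> W2}"]) (auto simp: separated_def)
  next
    case False
    have fin: "finite W1" "finite W2" using split.hyps block_tree_finite by blast+
    have inj: "inj_on snd W1" "inj_on snd W2" using split.prems inj_on_subset by blast+
    have "lowest snd (2 * s) (W1 \<union> W2) \<subseteq> ?c (W1 \<union> W2)"
      using False fin by (intro lowest_subset_lower_part lower_part_below) auto
    then have "lowest snd s W1 \<union> lowest snd s W2 \<subseteq> ?c (W1 \<union> W2)"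
      unfolding split.hyps(4) .
    then have "lowest snd s W1 \<subseteq> ?c W1" "lowest snd s W2 \<subseteq> ?c W2"
      using lowest_subset[of snd s W1] lowest_subset[of snd s W2] by blast+
    then have "card (lowest snd s W1) \<le> card (?c W1)" "card (lowest snd s W2) \<le> card (?c W2)"
      using fin by (auto intro!: card_mono)
    then have big: "s \<le> card (?c W1)" "s \<le> card (?c W2)"
      using card_lowest fin inj split.hyps(1,2) block_tree_card by (auto simp: card_lowest min_def split: if_splits)
    obtain F1 where F1: "F1 \<subseteq> B1" "separated F1" "\<Union>F1 = W1"
      "\<forall>A\<in>F1. card (?c A) < 2 * s \<and> (s \<le> card (?c W1) \<longrightarrow> s \<le> card (?c A))"
      using split.IH(1) inj by blast
    obtain F2 where F2: "F2 \<subseteq> B2" "separated F2" "\<Union>F2 = W2"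
      "\<forall>A\<in>F2. card (?c A) < 2 * s \<and> (s \<le> card (?c W2) \<longrightarrow> s \<le> card (?c A))"
      using split.IH(2) inj by blast
    have "separated (F1 \<union> F2)" using F1 F2 split.hyps(3) by (intro separated_Un) auto
    then show ?thesis using F1 F2 big by (intro exI[of _ "F1 \<union> F2"]) auto
  qed
qed

section \<open>Choosing one point in each leaf\<close>

text \<open>The highest of the \<open>\<lceil>s / 2\<rceil>\<close> lowest points of a leaf. The rank depends on \<open>s\<close> and not on the size of
  the leaf. A bottomless range that does not cut the leaf apart contains at least \<open>s / 2\<close> points of it
  if it contains this point, and a topless range contains at least \<open>(s + 1) / 2\<close> of them.\<close>

definition median :: "nat \<Rightarrow> point set \<Rightarrow> point" where
  "median s A = (SOME p. p \<in> lowest snd ((s + 1) div 2) A \<and>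
     (\<forall>q\<in>lowest snd ((s + 1) div 2) A. snd q \<le> snd p))"

definition lower_half :: "nat \<Rightarrow> point set set \<Rightarrow> point set" where
  "lower_half s \<L> = (\<Union>L\<in>\<L>. lowest snd ((s + 1) div 2) L)"

lemma median:
  assumes "finite A" "inj_on snd A" "0 < s" "s \<le> card A"
  shows "median s A \<in> lowest snd ((s + 1) div 2) A"
    and "q \<in> lowest snd ((s + 1) div 2) A \<Longrightarrow> snd q \<le> snd (median s A)"
proof -
  let ?D = "lowest snd ((s + 1) div 2) A"
  have "card ?D = (s + 1) div 2" using assms by (auto simp: card_lowest)
  then have "?D \<noteq> {}" using assms(3) by auto
  moreover have "finite ?D" using lowest_subset assms(1) by (rule finite_subset)
  ultimately have Max: "Max (snd ` ?D) \<in> snd ` ?D" "\<And>q. q \<in> ?D \<Longrightarrow> snd q \<le> Max (snd ` ?D)"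
    by simp_all
  obtain p where p: "Max (snd ` ?D) = snd p" "p \<in> ?D"
    using Max(1) by (rule imageE)
  have "\<forall>q\<in>?D. snd q \<le> snd p" using Max(2) unfolding p(1) by blast
  then have "\<exists>p. p \<in> ?D \<and> (\<forall>q\<in>?D. snd q \<le> snd p)" using p(2) by blast
  then have "median s A \<in> ?D \<and> (\<forall>q\<in>?D. snd q \<le> snd (median s A))"
    unfolding median_def by (rule someI_ex)
  then show "median s A \<in> ?D" "q \<in> ?D \<Longrightarrow> snd q \<le> snd (median s A)" by simp_all
qed

lemma below_median:
  assumes "finite A" "inj_on snd A" "0 < s" "s \<le> card A" "p \<in> A" "snd p \<le> snd (median s A)"
  shows "p \<in> lowest snd ((s + 1) div 2) A"
  using assms(5,6) median(1)[OF assms(1-4)] lower_part_lowest[OF assms(1), of snd "(s + 1) div 2"]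
  unfolding lower_part_def by blast

text \<open>A lower part that misses the median of a leaf cannot reach above it within that leaf.
  This is why points picked from birth sets without medians lie below the medians.\<close>

lemma unhit_in_lower_half:
  assumes V: "finite V" "inj_on snd V" "0 < s"
    and F: "lower_part snd F V" "z \<in> F" "F \<inter> median s ` \<K> = {}"
    and K: "\<Union>\<K> = V" "\<And>L. L \<in> \<K> \<Longrightarrow> s \<le> card L"
  shows "z \<in> lower_half s \<K>"
proof -
  have FV: "F \<subseteq> V" using F(1) by (simp add: lower_part_def)
  obtain L where L: "L \<in> \<K>" "z \<in> L" using F(2) FV K(1) by blast
  have LV: "L \<subseteq> V" using L(1) K(1) by blast
  have fL: "finite L" "inj_on snd L" "s \<le> card L"
    using LV V K(2)[OF L(1)] by (auto intro: finite_subset inj_on_subset)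
  have "median s L \<in> L"
    using median(1)[OF fL(1,2) V(3) fL(3)] lowest_subset by (rule subsetD[rotated])
  then have "median s L \<in> V" "median s L \<notin> F" using LV L(1) F(3) by blast+
  then have "snd z \<le> snd (median s L)"
    using F(1,2) unfolding lower_part_def by (meson linear)
  then show ?thesis
    using below_median[of L s z] fL L V(3) by (auto simp: lower_half_def)
qed

text \<open>The selection step when a block \<open>W\<close> is split. Here \<open>E\<close> is the birth set of \<open>W\<close>, \<open>V\<close> is one of the
  two children with birth set \<open>F\<close> and leaves \<open>\<K>\<close>, \<open>H\<close> contains the pick in \<open>E\<close> if there is one, and \<open>M\<close> is
  the set of medians. If \<open>H\<close> or \<open>M\<close> hits \<open>F\<close>, then the child inherits what lies in \<open>F\<close>. Otherwise \<open>F\<close> and \<open>E\<close>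
  are different sets, for \<open>E\<close> is hit, and as they have the same size, \<open>F\<close> has a point outside \<open>E\<close>. Picking
  such a new point does not add to the picks in \<open>E\<close>; this is what keeps their number at most one.\<close>

lemma pick_for_child:
  assumes W: "finite W" "inj_on snd W" "0 < s" "V \<subseteq> W"
    and E: "card E = s"
    and F: "lower_part snd F V" "card F = s" "E \<inter> V \<subseteq> F"
    and K: "\<Union>\<K> = V" "\<And>L. L \<in> \<K> \<Longrightarrow> s \<le> card L"
    and M: "M \<inter> V = median s ` \<K>"
    and H: "H \<subseteq> E" "card H \<le> 1" "H \<inter> V \<subseteq> lower_half s \<K>" "(H \<union> M) \<inter> E \<noteq> {}"
  shows "\<exists>H'. H' \<subseteq> F \<inter> lower_half s \<K> \<and> card H' \<le> 1 \<and> (H' \<union> median s ` \<K>) \<inter> F \<noteq> {} \<and> H' \<inter> E = H \<inter> V"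
proof (cases "(H \<union> M) \<inter> F = {}")
  case False
  have FV: "F \<subseteq> V" using F(1) by (simp add: lower_part_def)
  have fin: "finite E" using E W(3) card.infinite by fastforce
  then have "card (H \<inter> F) \<le> card H" using H(1) by (intro card_mono) (auto intro: finite_subset)
  moreover have "(H \<inter> F \<union> median s ` \<K>) \<inter> F \<noteq> {}"
    using False FV M by blast
  ultimately show ?thesis
    using H F FV by (intro exI[of _ "H \<inter> F"]) (auto simp: subset_iff)
next
  case True
  have finF: "finite F" "finite E" using F(2) E W(3) card.infinite by fastforce+
  have "\<not> F \<subseteq> E"
  proof
    assume "F \<subseteq> E"
    then have "F = E" using finF E F(2) card_subset_eq by metis
    then show False using H(4) True by blast
  qed
  then obtain z where z: "z \<in> F" "z \<notin> E" by blast
  have "finite V" "inj_on snd V" using W(1,2,4) by (auto intro: finite_subset inj_on_subset)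
  then have "z \<in> lower_half s \<K>"
    using W(3) F(1) z(1) M K True by (intro unhit_in_lower_half[of V s F]) auto
  moreover have "H \<inter> V = {}" using H(1) F(3) True by blast
  ultimately have "{z} \<subseteq> F \<inter> lower_half s \<K>" "({z} \<union> median s ` \<K>) \<inter> F \<noteq> {}" "{z} \<inter> E = H \<inter> V"
    using z by blast+
  then show ?thesis by (intro exI[of _ "{z}"]) simp
qed

text \<open>Given an admissible choice \<open>H\<close> of at most one pick in the birth set of the root, the picks of all
  blocks exist. No further pick falls into the birth set of the root, so that the choice can be passed down the tree
  unchanged. The bound \<open>2\<close> holds since the \<open>2 * s\<close> lowest points of a block are the union of the birth
  sets of its children, each with at most one pick.\<close>

lemma picks_exist:
  assumes "block_tree s W \<L> \<B>" "0 < s" "inj_on snd W"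
    and "H \<subseteq> lowest snd s W \<inter> lower_half s \<L>" "card H \<le> 1"
    and "(H \<union> median s ` \<L>) \<inter> lowest snd s W \<noteq> {}"
  shows "\<exists>P \<subseteq> lower_half s \<L>. P \<inter> lowest snd s W = H \<and>
    (\<forall>A\<in>\<B>. (P \<union> median s ` \<L>) \<inter> lowest snd s A \<noteq> {} \<and> card (P \<inter> lowest snd (2 * s) A) \<le> 2) \<and>
    (\<forall>L\<in>\<L>. card (P \<inter> L) \<le> 1)"
  using assms
proof (induction arbitrary: H rule: block_tree.induct)
  case (leaf A)
  have fH: "finite H"
    using leaf.prems(3) leaf.hyps(1) lowest_subset[of snd s A] by (meson finite_subset le_inf_iff)
  have "card (H \<inter> B) \<le> 1" for B
    using card_mono[OF fH, of "H \<inter> B"] leaf.prems(4) by simp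
  then have "card (H \<inter> B) \<le> 2" "card (H \<inter> B) \<le> 1" for B
    by (meson one_le_numeral order_trans)+
  then show ?case using leaf.prems by (intro exI[of _ H]) auto
next
  case (split W1 L1 B1 W2 L2 B2)
  let ?M = "median s ` (L1 \<union> L2)"
  note bt = split.hyps(1,2)
  have inj: "inj_on snd W1" "inj_on snd W2" using split.prems(2) inj_on_subset by blast+
  have fin: "finite W1" "finite W2" using bt block_tree_finite by blast+
  have disj: "W1 \<inter> W2 = {}" using split.hyps(3) by (rule left_of_disjoint)
  have cs: "s \<le> card W1" "s \<le> card W2" "s \<le> card (W1 \<union> W2)"
    using bt block_tree_card block_tree_card[OF block_tree.split[OF split.hyps]] by blast+
  have medians: "median s ` K \<subseteq> V" "lower_half s K \<subseteq> V"
    if "block_tree s V K B" "inj_on snd V" for V K B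
  proof -
    have "\<And>L. L \<in> K \<Longrightarrow> L \<subseteq> V" using block_tree_leaves(1)[OF that(1)] by blast
    moreover have "median s L \<in> L" if "L \<in> K" for L
      using median(1)[of L s] lowest_subset[of snd _ L] block_tree_finite[OF \<open>block_tree s V K B\<close>]
        block_tree_leaves(3)[OF \<open>block_tree s V K B\<close> that] calculation[OF that] \<open>0 < s\<close>
        inj_on_subset[OF \<open>inj_on snd V\<close>] finite_subset by blast
    ultimately show "median s ` K \<subseteq> V" by blast
    show "lower_half s K \<subseteq> V" unfolding lower_half_def
      by (intro UN_least order_trans[OF lowest_subset] \<open>\<And>L. L \<in> K \<Longrightarrow> L \<subseteq> V\<close>)
  qed
  note m1 = medians[OF bt(1) inj(1)] and m2 = medians[OF bt(2) inj(2)]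
  define E where "E = lowest snd s (W1 \<union> W2)"
  define E1 where "E1 = lowest snd s W1"
  define E2 where "E2 = lowest snd s W2"
  have cE: "card E = s" "card E1 = s" "card E2 = s"
    using fin inj split.prems(2) cs by (simp_all add: E_def E1_def E2_def card_lowest)
  have lp: "lower_part snd E1 W1" "lower_part snd E2 W2"
    using fin by (simp_all add: E1_def E2_def lower_part_lowest)
  have sub: "E1 \<subseteq> W1" "E2 \<subseteq> W2" by (auto simp: E1_def E2_def lowest_subset)
  have "E \<subseteq> lowest snd (2 * s) (W1 \<union> W2)" by (auto simp: E_def lowest_def)
  then have E12: "E \<subseteq> E1 \<union> E2" unfolding split.hyps(4) E1_def E2_def .
  then have EW: "E \<inter> W1 \<subseteq> E1" "E \<inter> W2 \<subseteq> E2" using sub disj by blast+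
  have M: "?M \<inter> W1 = median s ` L1" "?M \<inter> W2 = median s ` L2"
    using m1(1) m2(1) disj by blast+
  have lh: "lower_half s (L1 \<union> L2) = lower_half s L1 \<union> lower_half s L2"
    by (auto simp: lower_half_def)
  have H: "H \<subseteq> E" "H \<inter> W1 \<subseteq> lower_half s L1" "H \<inter> W2 \<subseteq> lower_half s L2" "(H \<union> ?M) \<inter> E \<noteq> {}"
    using split.prems(3,5) lh m1(2) m2(2) disj by (auto simp: E_def)
  have fU: "finite (W1 \<union> W2)" using fin by simp
  obtain H1 where H1: "H1 \<subseteq> E1 \<inter> lower_half s L1" "card H1 \<le> 1"
      "(H1 \<union> median s ` L1) \<inter> E1 \<noteq> {}" "H1 \<inter> E = H \<inter> W1"
    using pick_for_child[OF fU split.prems(2) \<open>0 < s\<close> _ cE(1) lp(1) cE(2) EW(1)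
        block_tree_leaves(1)[OF bt(1)] block_tree_leaves(3)[OF bt(1)] M(1) H(1) split.prems(4) H(2) H(4)]
    by blast
  obtain H2 where H2: "H2 \<subseteq> E2 \<inter> lower_half s L2" "card H2 \<le> 1"
      "(H2 \<union> median s ` L2) \<inter> E2 \<noteq> {}" "H2 \<inter> E = H \<inter> W2"
    using pick_for_child[OF fU split.prems(2) \<open>0 < s\<close> _ cE(1) lp(2) cE(3) EW(2)
        block_tree_leaves(1)[OF bt(2)] block_tree_leaves(3)[OF bt(2)] M(2) H(1) split.prems(4) H(3) H(4)]
    by blast
  obtain P1 where P1: "P1 \<subseteq> lower_half s L1" "P1 \<inter> E1 = H1"
    "\<forall>A\<in>B1. (P1 \<union> median s ` L1) \<inter> lowest snd s A \<noteq> {} \<and> card (P1 \<inter> lowest snd (2 * s) A) \<le> 2"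
    "\<forall>L\<in>L1. card (P1 \<inter> L) \<le> 1"
    using split.IH(1)[OF \<open>0 < s\<close> inj(1), of H1] H1 unfolding E1_def by blast
  obtain P2 where P2: "P2 \<subseteq> lower_half s L2" "P2 \<inter> E2 = H2"
    "\<forall>A\<in>B2. (P2 \<union> median s ` L2) \<inter> lowest snd s A \<noteq> {} \<and> card (P2 \<inter> lowest snd (2 * s) A) \<le> 2"
    "\<forall>L\<in>L2. card (P2 \<inter> L) \<le> 1"
    using split.IH(2)[OF \<open>0 < s\<close> inj(2), of H2] H2 unfolding E2_def by blast
  define P where "P = P1 \<union> P2"
  have P1W: "P1 \<subseteq> W1" and P2W: "P2 \<subseteq> W2" using P1(1) P2(1) m1 m2 by blast+
  have loc: "P \<inter> V = P1 \<inter> V" if "V \<subseteq> W1" for V using that P2W disj unfolding P_def by blast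
  have loc': "P \<inter> V = P2 \<inter> V" if "V \<subseteq> W2" for V using that P1W disj unfolding P_def by blast
  have PE: "P \<inter> E = H"
  proof -
    have "P1 \<inter> E = H1 \<inter> E" "P2 \<inter> E = H2 \<inter> E"
      using P1(2) P2(2) P1W P2W EW by blast+
    then show ?thesis using H1(4) H2(4) H(1) E12 sub unfolding P_def by blast
  qed
  have P2s: "card (P \<inter> lowest snd (2 * s) (W1 \<union> W2)) \<le> 2"
  proof -
    have "P \<inter> lowest snd (2 * s) (W1 \<union> W2) = H1 \<union> H2"
      unfolding split.hyps(4) E1_def[symmetric] E2_def[symmetric]
      using P1(2) P2(2) loc[OF sub(1)] loc'[OF sub(2)] by blast
    moreover have "card (H1 \<union> H2) \<le> card H1 + card H2" by (rule card_Un_le)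
    ultimately show ?thesis using H1(2) H2(2) by simp
  qed
  have blocks1: "(P \<union> ?M) \<inter> lowest snd s A \<noteq> {} \<and> card (P \<inter> lowest snd (2 * s) A) \<le> 2"
    if "A \<in> B1" for A
  proof -
    have "lowest snd (2 * s) A \<subseteq> W1"
      by (intro order_trans[OF lowest_subset] block_tree_blocks_subset[OF bt(1) that])
    then have "P \<inter> lowest snd (2 * s) A = P1 \<inter> lowest snd (2 * s) A" by (rule loc)
    moreover have "(P1 \<union> median s ` L1) \<inter> lowest snd s A \<subseteq> (P \<union> ?M) \<inter> lowest snd s A"
      unfolding P_def by blast
    ultimately show ?thesis using P1(3) that by (metis subset_empty)
  qed
  have blocks2: "(P \<union> ?M) \<inter> lowest snd s A \<noteq> {} \<and> card (P \<inter> lowest snd (2 * s) A) \<le> 2"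
    if "A \<in> B2" for A
  proof -
    have "lowest snd (2 * s) A \<subseteq> W2"
      by (intro order_trans[OF lowest_subset] block_tree_blocks_subset[OF bt(2) that])
    then have "P \<inter> lowest snd (2 * s) A = P2 \<inter> lowest snd (2 * s) A" by (rule loc')
    moreover have "(P2 \<union> median s ` L2) \<inter> lowest snd s A \<subseteq> (P \<union> ?M) \<inter> lowest snd s A"
      unfolding P_def by blast
    ultimately show ?thesis using P2(3) that by (metis subset_empty)
  qed
  have root: "(P \<union> ?M) \<inter> lowest snd s (W1 \<union> W2) \<noteq> {}"
    using H(4) PE unfolding E_def by blast
  have leaves1: "card (P \<inter> L) \<le> 1" if "L \<in> L1" for L
  proof -
    have "L \<subseteq> W1" using that block_tree_leaves(1)[OF bt(1)] by blast
    then show ?thesis using that P1(4) loc by simp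
  qed
  have leaves2: "card (P \<inter> L) \<le> 1" if "L \<in> L2" for L
  proof -
    have "L \<subseteq> W2" using that block_tree_leaves(1)[OF bt(2)] by blast
    then show ?thesis using that P2(4) loc' by simp
  qed
  have "P \<subseteq> lower_half s (L1 \<union> L2)" using P1(1) P2(1) lh P_def by blast
  then show ?case
    using PE root P2s blocks1 blocks2 leaves1 leaves2 unfolding E_def
    by (intro exI[of _ P]) (simp add: ball_Un)
qed

section \<open>A shallow transversal for bottomless ranges\<close>

text \<open>The counting principle for everything that follows. A slab cuts apart at most two members of a separated family.
  Every other member that meets the set \<open>Y\<close> in the slab lies inside the slab and uses up at least \<open>u\<close> points
  of \<open>Q\<close>, which bounds the number of these members.\<close>

lemma separated_count:
  assumes sep: "separated \<A>" "finite \<A>"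
    and Y: "Y \<subseteq> \<Union>\<A>" "\<And>p. p \<in> Y \<Longrightarrow> fst p \<in> {a..b}" "\<And>A. A \<in> \<A> \<Longrightarrow> card (Y \<inter> A) \<le> t"
    and Q: "finite Q"
      "\<And>A. A \<in> \<A> \<Longrightarrow> Y \<inter> A \<noteq> {} \<Longrightarrow> fst ` A \<subseteq> {a..b} \<Longrightarrow> u \<le> card (A \<inter> Q)"
  shows "u * card Y \<le> t * (card Q + 2 * u)"
proof -
  define I where "I = {A \<in> \<A>. Y \<inter> A \<noteq> {} \<and> fst ` A \<subseteq> {a..b}}"
  have I: "finite I" "I \<subseteq> \<A>" using sep(2) by (auto simp: I_def)
  have c: "finite (cut_by a b \<A>)" "cut_by a b \<A> \<subseteq> \<A>" using sep(2) by (auto simp: cut_by_def)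
  have cover: "Y \<subseteq> (\<Union>A \<in> I \<union> cut_by a b \<A>. Y \<inter> A)"
  proof
    fix p assume p: "p \<in> Y"
    then obtain A where A: "A \<in> \<A>" "p \<in> A" using Y(1) by blast
    have "A \<in> I \<or> A \<in> cut_by a b \<A>"
      using A p Y(2)[OF p] unfolding I_def cut_by_def by blast
    then show "p \<in> (\<Union>A \<in> I \<union> cut_by a b \<A>. Y \<inter> A)" using p A by blast
  qed
  have disj: "(A \<inter> Q) \<inter> (B \<inter> Q) = {}" if "A \<in> I" "B \<in> I" "A \<noteq> B" for A B
    using that separated_disjoint[OF sep(1)] I(2) by blast
  have "u * card I \<le> (\<Sum>A\<in>I. card (A \<inter> Q))"
    using Q(2) sum_bounded_below[of I u "\<lambda>A. card (A \<inter> Q)"] by (auto simp: I_def mult.commute)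
  also have "\<dots> = card (\<Union>A\<in>I. A \<inter> Q)"
    using I Q(1) disj by (intro card_UN_disjoint[symmetric]) auto
  also have "\<dots> \<le> card Q"
    using Q(1) by (intro card_mono) auto
  finally have inner: "u * card I \<le> card Q" .
  show ?thesis
  proof (cases "finite Y")
    case False
    then show ?thesis by simp
  next
    case True
    have "card Y \<le> card (\<Union>A \<in> I \<union> cut_by a b \<A>. Y \<inter> A)"
      using cover I(1) c(1) True by (intro card_mono) auto
    also have "\<dots> \<le> (\<Sum>A \<in> I \<union> cut_by a b \<A>. card (Y \<inter> A))"
      using I(1) c(1) by (intro card_UN_le) auto
    also have "\<dots> \<le> card (I \<union> cut_by a b \<A>) * t"
      using sum_bounded_above[of "I \<union> cut_by a b \<A>" "\<lambda>A. card (Y \<inter> A)" t] Y(3) I(2) c(2) by auto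
    also have "\<dots> \<le> (card I + 2) * t"
      using card_Un_le[of I "cut_by a b \<A>"] card_cut_by[OF sep, of a b] by (intro mult_right_mono) auto
    finally have "u * card Y \<le> u * ((card I + 2) * t)" by (rule mult_left_mono) simp
    also have "\<dots> = t * (u * card I + 2 * u)" by (simp add: algebra_simps)
    also have "\<dots> \<le> t * (card Q + 2 * u)" using inner by (intro mult_left_mono) auto
    finally show ?thesis .
  qed
qed

text \<open>Replaces the cost \<open>u\<close> by a bound \<open>v \<le> 2 * u\<close>. For \<open>u = \<lceil>s / 2\<rceil>\<close> this gets rid of the rounding.\<close>

lemma rescale_count:
  assumes "u * y \<le> n + 2 * u" "v \<le> 2 * (u :: nat)"
  shows "v * y \<le> 2 * n + 2 * v"
proof (cases "y \<le> 2")
  case True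
  then have "v * y \<le> v * 2" by (rule mult_left_mono) simp
  then show ?thesis by linarith
next
  case False
  then obtain j where j: "y = j + 2" by (metis add.commute le_Suc_ex nat_le_linear)
  have "u * j \<le> n" using assms(1) by (simp add: j algebra_simps)
  moreover have "v * j \<le> 2 * u * j" using assms(2) by (rule mult_right_mono) simp
  moreover have "v * y = v * j + 2 * v" "2 * u * j = 2 * (u * j)" by (simp_all add: j algebra_simps)
  ultimately show ?thesis by linarith
qed

text \<open>The birth set of the root starts the selection: if no median hits it, any of its points may be
  picked.\<close>

lemma root_picks:
  assumes "block_tree s W \<L> \<B>" "0 < s" "inj_on snd W"
  shows "\<exists>P \<subseteq> lower_half s \<L>. card (P \<inter> lowest snd s W) \<le> 1 \<and>
    (\<forall>A\<in>\<B>. (P \<union> median s ` \<L>) \<inter> lowest snd s A \<noteq> {} \<and> card (P \<inter> lowest snd (2 * s) A) \<le> 2) \<and>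
    (\<forall>L\<in>\<L>. card (P \<inter> L) \<le> 1)"
proof -
  let ?E = "lowest snd s W"
  have fin: "finite W" using assms(1) by (rule block_tree_finite)
  have "\<exists>H \<subseteq> ?E \<inter> lower_half s \<L>. card H \<le> 1 \<and> (H \<union> median s ` \<L>) \<inter> ?E \<noteq> {}"
  proof (cases "?E \<inter> median s ` \<L> = {}")
    case False
    then show ?thesis by (intro exI[of _ "{}"]) auto
  next
    case True
    have "card ?E = s"
      using card_lowest[OF fin assms(3)] block_tree_card[OF assms(1)] by simp
    then have "?E \<noteq> {}" using assms(2) by auto
    then obtain z where z: "z \<in> ?E" by blast
    have "z \<in> lower_half s \<L>"
      using fin assms(3,2) lower_part_lowest[OF fin] z True block_tree_leaves(1,3)[OF assms(1)]
      by (rule unhit_in_lower_half)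
    then show ?thesis using z by (intro exI[of _ "{z}"]) auto
  qed
  then obtain H where H: "H \<subseteq> ?E \<inter> lower_half s \<L>" "card H \<le> 1" "(H \<union> median s ` \<L>) \<inter> ?E \<noteq> {}"
    by blast
  show ?thesis using picks_exist[OF assms H] H(2) by metis
qed

text \<open>Medians are only kept in leaves without picks, so that every leaf contributes exactly one point.\<close>

lemma leaf_transversal:
  assumes bt: "block_tree s W \<L> \<B>" and s: "0 < s" and inj: "inj_on snd W"
    and P: "P \<subseteq> lower_half s \<L>" "\<forall>L\<in>\<L>. card (P \<inter> L) \<le> 1"
  defines "X \<equiv> P \<union> median s ` {L \<in> \<L>. P \<inter> L = {}}"
  shows "X \<subseteq> W" "\<And>L. L \<in> \<L> \<Longrightarrow> card (X \<inter> L) \<le> 1"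
    "\<And>L. L \<in> \<L> \<Longrightarrow> X \<inter> L \<subseteq> lowest snd ((s + 1) div 2) L"
    "\<And>L. L \<in> \<L> \<Longrightarrow> X \<inter> L \<noteq> {}"
proof -
  note lv = block_tree_leaves[OF bt]
  have low: "lowest snd n L \<subseteq> L" for n and L :: "point set" by (rule lowest_subset)
  have med: "median s L \<in> lowest snd ((s + 1) div 2) L" "median s L \<in> L" if "L \<in> \<L>" for L
  proof -
    have "L \<subseteq> W" using that lv(1) by blast
    then show "median s L \<in> lowest snd ((s + 1) div 2) L"
      using that lv(3) s inj block_tree_finite[OF bt]
      by (intro median(1)) (auto intro: finite_subset inj_on_subset)
    then show "median s L \<in> L" using low by blast
  qed
  have eq: "L = L'" if "L \<in> \<L>" "L' \<in> \<L>" "p \<in> L" "p \<in> L'" for L L' p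
    using separated_disjoint[OF lv(2)] that by blast
  have Plow: "P \<inter> L \<subseteq> lowest snd ((s + 1) div 2) L" if "L \<in> \<L>" for L
  proof
    fix p assume p: "p \<in> P \<inter> L"
    then obtain L' where L': "L' \<in> \<L>" "p \<in> lowest snd ((s + 1) div 2) L'"
      using P(1) unfolding lower_half_def by blast
    then have "L' = L" using eq[of L' L p] that p low by blast
    then show "p \<in> lowest snd ((s + 1) div 2) L" using L' by simp
  qed
  have XL: "X \<inter> L = (if P \<inter> L = {} then {median s L} else P \<inter> L)" if "L \<in> \<L>" for L
  proof -
    have "K = L" if "K \<in> \<L>" "median s K \<in> L" for K
      using eq[OF that(1) \<open>L \<in> \<L>\<close> med(2)[OF that(1)] that(2)] .
    then have "{K \<in> \<L>. P \<inter> K = {} \<and> median s K \<in> L} = {K \<in> {L}. P \<inter> K = {}}"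
      using that med(2)[OF that] by blast
    moreover have "median s ` {K \<in> \<L>. P \<inter> K = {}} \<inter> L
      = median s ` {K \<in> \<L>. P \<inter> K = {} \<and> median s K \<in> L}" by blast
    ultimately have "median s ` {K \<in> \<L>. P \<inter> K = {}} \<inter> L = median s ` {K \<in> {L}. P \<inter> K = {}}"
      by simp
    then show ?thesis unfolding X_def Int_Un_distrib2 by auto
  qed
  show "card (X \<inter> L) \<le> 1" "X \<inter> L \<subseteq> lowest snd ((s + 1) div 2) L" "X \<inter> L \<noteq> {}" if "L \<in> \<L>" for L
    using XL[OF that] P(2) that Plow[OF that] med[OF that] by (auto split: if_splits)
  have "P \<subseteq> W"
  proof
    fix p assume "p \<in> P"
    then obtain L where "L \<in> \<L>" "p \<in> L" using P(1) low unfolding lower_half_def by blast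
    then show "p \<in> W" using lv(1) by blast
  qed
  then show "X \<subseteq> W" using med(2) lv(1) unfolding X_def by blast
qed

lemma subset_TimesI: "fst ` A \<subseteq> S \<Longrightarrow> snd ` A \<subseteq> T \<Longrightarrow> A \<subseteq> S \<times> T"
  by (rule order_trans[OF subset_fst_snd Sigma_mono])

text \<open>The first conclusion says that ranges with enough points are hit. The second bounds the number of
  chosen points in a bottomless range: picks are counted via the frontier at height \<open>c\<close>, at most two per
  block of at least \<open>s\<close> points, and medians are counted via the leaves, where each one costs at least \<open>s / 2\<close> points. The third
  bounds the number of chosen points in a topless range, where each leaf costs at least \<open>(s + 1) / 2\<close>
  points. Both bounds add a constant for the two members of each family that are cut apart. The slack
  of the third bound, \<open>s + 1\<close> in place of \<open>s\<close>, is what brings the final total down to 63.\<close>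

lemma bottomless_transversal:
  fixes W :: "point set"
  assumes W: "finite W" "inj_on fst W" "inj_on snd W" and s: "0 < s"
  shows "\<exists>X \<subseteq> W.
    (\<forall>a b c. 4 * s - 3 \<le> card (W \<inter> {a..b} \<times> {..c}) \<longrightarrow> X \<inter> {a..b} \<times> {..c} \<noteq> {}) \<and>
    (\<forall>a b c. s * card (X \<inter> {a..b} \<times> {..c}) \<le> 4 * card (W \<inter> {a..b} \<times> {..c}) + 6 * s) \<and>
    (\<forall>a b c. (s + 1) * card (X \<inter> {a..b} \<times> {c..}) \<le> 2 * card (W \<inter> {a..b} \<times> {c..}) + 2 * (s + 1))"
proof (cases "s \<le> card W")
  case False
  have "card (W \<inter> R) < s" for R
    using False card_mono[OF W(1), of "W \<inter> R"] by simp
  moreover have "s \<le> 4 * s - 3" using s by simp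
  ultimately have "\<not> 4 * s - 3 \<le> card (W \<inter> R)" for R
    by (meson leD order_trans)
  then show ?thesis by (intro exI[of _ "{}"]) simp
next
  case True
  obtain \<L> \<B> where bt: "block_tree s W \<L> \<B>"
    using block_tree_exists[OF W s True] by blast
  note lv = block_tree_leaves[OF bt]
  let ?r = "(s + 1) div 2"
  let ?M = "median s ` \<L>"
  obtain P where P: "P \<subseteq> lower_half s \<L>" "card (P \<inter> lowest snd s W) \<le> 1"
    "\<And>A. A \<in> \<B> \<Longrightarrow> (P \<union> ?M) \<inter> lowest snd s A \<noteq> {}"
    "\<And>A. A \<in> \<B> \<Longrightarrow> card (P \<inter> lowest snd (2 * s) A) \<le> 2"
    "\<forall>L\<in>\<L>. card (P \<inter> L) \<le> 1"
    using root_picks[OF bt s W(3)] by blast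
  define X where "X = P \<union> median s ` {L \<in> \<L>. P \<inter> L = {}}"
  note X = leaf_transversal[OF bt s W(3) P(1,5), folded X_def]
  have fL: "finite \<L>" using W(1) lv(1) by (metis finite_UnionD)
  have leaf: "L \<subseteq> W" "finite L" "inj_on snd L" if "L \<in> \<L>" for L
  proof -
    show "L \<subseteq> W" using that lv(1) by blast
    then show "finite L" "inj_on snd L" using W by (auto intro: finite_subset inj_on_subset)
  qed
  have med: "median s L \<in> lowest snd ?r L" "median s L \<in> L"
    "\<And>q. q \<in> lowest snd ?r L \<Longrightarrow> snd q \<le> snd (median s L)" if "L \<in> \<L>" for L
    using median[OF leaf(2,3)[OF that] s lv(3)[OF that]] lowest_subset[of snd ?r L] by blast+
  have X_sub: "X \<subseteq> P \<union> ?M" by (auto simp: X_def)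
  have finX: "finite X" using X(1) W(1) by (rule finite_subset)
  have finP: "finite P" using finX by (simp add: X_def)

  have hit: "X \<inter> {a..b} \<times> {..c} \<noteq> {}" if big: "4 * s - 3 \<le> card (W \<inter> {a..b} \<times> {..c})" for a b c
  proof (rule ccontr)
    assume un: "\<not> ?thesis"
    let ?c = "\<lambda>A. {p \<in> A. snd p \<le> c}"
    obtain \<F> where F: "\<F> \<subseteq> \<B>" "separated \<F>" "\<Union>\<F> = W" "\<And>A. A \<in> \<F> \<Longrightarrow> card (?c A) < 2 * s"
      "\<And>A. A \<in> \<F> \<Longrightarrow> s \<le> card (?c W) \<Longrightarrow> s \<le> card (?c A)"
      using block_tree_frontier[OF bt W(3), of c] by blast
    have fF: "finite \<F>" using finite_UnionD[of \<F>] F(3) W(1) by simp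
    have "card (W \<inter> {a..b} \<times> {..c}) \<le> card (?c W)"
      using W(1) by (intro card_mono) auto
    then have sc: "s \<le> card (?c W)" using big s by linarith
    (* A block of the frontier whose present part lies inside the range would make the range hit. *)
    have outside: "\<not> fst ` ?c A \<subseteq> {a..b}" if A: "A \<in> \<F>" for A
    proof
      assume in_ab: "fst ` ?c A \<subseteq> {a..b}"
      have AB: "A \<in> \<B>" using A F(1) by blast
      have AW: "A \<subseteq> W" using block_tree_blocks_subset[OF bt AB] .
      have fA: "finite A" using AW W(1) by (rule finite_subset)
      have "lowest snd s A \<subseteq> ?c A"
        using F(5)[OF A sc] fA by (intro lowest_subset_lower_part lower_part_below) auto
      then obtain p where p: "p \<in> P \<union> ?M" "p \<in> A" "snd p \<le> c" using P(3)[OF AB] by blast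
      then obtain L where L: "L \<in> \<L>" "p \<in> L" using AW lv(1) by blast
      have LA: "L \<subseteq> A" using block_tree_leaf_in_block[OF bt AB L(1)] L(2) p(2) by blast
      have in_R: "q \<in> {a..b} \<times> {..c}" if "q \<in> A" "snd q \<le> c" for q
      proof -
        have "fst q \<in> {a..b}" using that in_ab by blast
        then show ?thesis using that(2) by (simp add: mem_Times_iff)
      qed
      obtain x where x: "x \<in> X" "x \<in> L" using X(4)[OF L(1)] by blast
      show False
      proof (cases "p \<in> P")
        case True
        then have "p \<in> X \<inter> {a..b} \<times> {..c}"
          using in_R[OF p(2,3)] by (simp add: X_def)
        then show False using un by blast
      next
        case False
        then obtain K where K: "K \<in> \<L>" "p = median s K" using p(1) by blast
        then have "K = L" using separated_disjoint[OF lv(2) K(1) L(1)] med(2)[OF K(1)] L(2) by blast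
        then have "snd x \<le> snd p" using med(3)[OF K(1), of x] X(3)[OF L(1)] x K(2) by blast
        then have "x \<in> X \<inter> {a..b} \<times> {..c}"
          using in_R[of x] x p(3) LA by (meson IntI order_trans subsetD)
        then show False using un by blast
      qed
    qed
    (* So every block of the frontier that meets the range is cut apart: at most two blocks, each with
       at most 2 * s - 2 points in the range. No member lies inside, whence the trivial Q and u. *)
    have "1 * card (W \<inter> {a..b} \<times> {..c}) \<le> (2 * s - 2) * (card ({} :: point set) + 2 * 1)"
    proof (rule separated_count[where \<A> = "?c ` \<F>" and a = a and b = b])
      show "separated (?c ` \<F>)"
        using separated_refine[OF F(2), of "{p. snd p \<le> c}"] by (simp add: Int_def)
      show "finite (?c ` \<F>)" using fF by simp
      show "W \<inter> {a..b} \<times> {..c} \<subseteq> \<Union> (?c ` \<F>)"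
        using F(3) by (fastforce simp: mem_Times_iff)
      show "fst p \<in> {a..b}" if "p \<in> W \<inter> {a..b} \<times> {..c}" for p using that by (simp add: mem_Times_iff)
      show "finite ({} :: point set)" by simp
      show "card (W \<inter> {a..b} \<times> {..c} \<inter> A') \<le> 2 * s - 2" if "A' \<in> ?c ` \<F>" for A'
      proof -
        obtain A where A: "A \<in> \<F>" "A' = ?c A" using \<open>A' \<in> ?c ` \<F>\<close> by blast
        obtain q where q: "q \<in> ?c A" "fst q \<notin> {a..b}" using outside[OF A(1)] by blast
        have "A \<subseteq> W" using A(1) F(3) by blast
        then have fA: "finite (?c A)" using W(1) by (auto intro: finite_subset)
        have "card (W \<inter> {a..b} \<times> {..c} \<inter> A') \<le> card (?c A - {q})"
          using A(2) q(2) fA by (intro card_mono) auto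
        also have "\<dots> = card (?c A) - 1" using q(1) fA by simp
        finally show ?thesis using F(4)[OF A(1)] by linarith
      qed
      show "1 \<le> card (A' \<inter> {})" if "A' \<in> ?c ` \<F>" "fst ` A' \<subseteq> {a..b}" for A'
        using that outside by blast
    qed
    then show False using big s by simp
  qed

  have own: "s * card (X \<inter> {a..b} \<times> {..c}) \<le> 4 * card (W \<inter> {a..b} \<times> {..c}) + 6 * s" for a b c
  proof -
    let ?c = "\<lambda>A. {p \<in> A. snd p \<le> c}"
    let ?R = "{a..b} \<times> {..c}"
    let ?N = "card (W \<inter> ?R)"
    have picks: "s * card (P \<inter> ?R) \<le> 2 * (?N + 2 * s)"
    proof (cases "s \<le> card (?c W)")
      case False
      then have "?c W \<subseteq> lowest snd s W"
        using W(1) by (intro lower_part_subset_lowest lower_part_below) auto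
      then have "P \<inter> ?R \<subseteq> P \<inter> lowest snd s W" using X(1) by (auto simp: X_def)
      then have "card (P \<inter> ?R) \<le> 1" using P(2) finP card_mono[of "P \<inter> lowest snd s W" "P \<inter> ?R"] by simp
      then have "s * card (P \<inter> ?R) \<le> s * 1" by (rule mult_left_mono) simp
      also have "\<dots> \<le> 2 * (?N + 2 * s)" by simp
      finally show ?thesis .
    next
      case True
      obtain \<F> where F: "\<F> \<subseteq> \<B>" "separated \<F>" "\<Union>\<F> = W" "\<And>A. A \<in> \<F> \<Longrightarrow> card (?c A) < 2 * s"
        "\<And>A. A \<in> \<F> \<Longrightarrow> s \<le> card (?c A)"
        using block_tree_frontier[OF bt W(3), of c] True by blast
      have fF: "finite \<F>" using finite_UnionD[of \<F>] F(3) W(1) by simp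
      have AW: "A \<subseteq> W" "finite A" if "A \<in> \<F>" for A
      proof -
        show "A \<subseteq> W" using that F(3) by blast
        then show "finite A" using W(1) by (rule finite_subset)
      qed
      show ?thesis
      proof (rule separated_count[where \<A> = "?c ` \<F>" and a = a and b = b])
        show "separated (?c ` \<F>)"
          using separated_refine[OF F(2), of "{p. snd p \<le> c}"] by (simp add: Int_def)
        show "finite (?c ` \<F>)" using fF by simp
        show "P \<inter> ?R \<subseteq> \<Union> (?c ` \<F>)"
          using F(3) X(1) by (fastforce simp: X_def mem_Times_iff)
        show "fst p \<in> {a..b}" if "p \<in> P \<inter> ?R" for p using that by (simp add: mem_Times_iff)
        show "finite (W \<inter> ?R)" using W(1) by simp
        show "card (P \<inter> ?R \<inter> A') \<le> 2" if "A' \<in> ?c ` \<F>" for A'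
        proof -
          obtain A where A: "A \<in> \<F>" "A' = ?c A" using \<open>A' \<in> ?c ` \<F>\<close> by blast
          have "?c A \<subseteq> lowest snd (2 * s) A"
            using F(4)[OF A(1)] AW(2)[OF A(1)] by (intro lower_part_subset_lowest lower_part_below) auto
          then have "card (P \<inter> ?R \<inter> A') \<le> card (P \<inter> lowest snd (2 * s) A)"
            using finP A(2) by (intro card_mono) auto
          also have "\<dots> \<le> 2" using A(1) F(1) by (intro P(4)) auto
          finally show ?thesis .
        qed
        show "s \<le> card (A' \<inter> (W \<inter> ?R))" if "A' \<in> ?c ` \<F>" "fst ` A' \<subseteq> {a..b}" for A'
        proof -
          obtain A where A: "A \<in> \<F>" "A' = ?c A" using \<open>A' \<in> ?c ` \<F>\<close> by blast
          have "A' \<subseteq> ?R" using that(2) A(2) by (intro subset_TimesI) auto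
          then have "A' \<inter> (W \<inter> ?R) = ?c A" using AW(1)[OF A(1)] A(2) by blast
          then show ?thesis using F(5)[OF A(1)] by simp
        qed
      qed
    qed
    have "?r * card (?M \<inter> ?R) \<le> 1 * (?N + 2 * ?r)"
    proof (rule separated_count[OF lv(2) fL, where a = a and b = b])
      show "?M \<inter> ?R \<subseteq> \<Union>\<L>" using med(2) by blast
      show "fst p \<in> {a..b}" if "p \<in> ?M \<inter> ?R" for p using that by (simp add: mem_Times_iff)
      show "finite (W \<inter> ?R)" using W(1) by simp
      have one: "?M \<inter> L \<subseteq> {median s L}" if "L \<in> \<L>" for L
        using separated_disjoint[OF lv(2) _ that] med(2) by blast
      show "card (?M \<inter> ?R \<inter> L) \<le> 1" if "L \<in> \<L>" for L
        using card_mono[of "{median s L}" "?M \<inter> ?R \<inter> L"] one[OF that] by auto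
      show "?r \<le> card (L \<inter> (W \<inter> ?R))" if L: "L \<in> \<L>" "?M \<inter> ?R \<inter> L \<noteq> {}" "fst ` L \<subseteq> {a..b}" for L
      proof -
        obtain p where p: "p \<in> ?M \<inter> ?R \<inter> L"
          using L(2) unfolding ex_in_conv[symmetric] by (rule exE)
        have "p = median s L" using subsetD[OF one[OF L(1)], of p] p by simp
        then have "snd (median s L) \<le> c" using p by (simp add: mem_Times_iff)
        then have "snd q \<le> c" if "q \<in> lowest snd ?r L" for q
          using med(3)[OF L(1) that] by linarith
        then have "snd ` lowest snd ?r L \<subseteq> {..c}" by blast
        moreover have "fst ` lowest snd ?r L \<subseteq> {a..b}"
          using L(3) lowest_subset[of snd ?r L] by blast
        ultimately have "lowest snd ?r L \<subseteq> ?R" by (intro subset_TimesI)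
        then have "lowest snd ?r L \<subseteq> L \<inter> (W \<inter> ?R)"
          using lowest_subset[of snd ?r L] leaf(1)[OF L(1)] by blast
        then have "card (lowest snd ?r L) \<le> card (L \<inter> (W \<inter> ?R))"
          using W(1) by (intro card_mono) auto
        moreover have "card (lowest snd ?r L) = ?r"
          using card_lowest[OF leaf(2,3)[OF L(1)], of ?r] lv(3)[OF L(1)] s by simp
        ultimately show ?thesis by simp
      qed
    qed
    then have medians: "s * card (?M \<inter> ?R) \<le> 2 * ?N + 2 * s"
      by (intro rescale_count[of ?r]) auto
    have "card (X \<inter> ?R) \<le> card (P \<inter> ?R \<union> ?M \<inter> ?R)"
      using X_sub finP fL by (intro card_mono) auto
    also have "\<dots> \<le> card (P \<inter> ?R) + card (?M \<inter> ?R)" by (rule card_Un_le)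
    finally have "s * card (X \<inter> ?R) \<le> s * (card (P \<inter> ?R) + card (?M \<inter> ?R))"
      by (rule mult_left_mono) simp
    also have "\<dots> = s * card (P \<inter> ?R) + s * card (?M \<inter> ?R)" by (rule distrib_left)
    also have "\<dots> \<le> 2 * (?N + 2 * s) + (2 * ?N + 2 * s)"
      by (rule add_mono[OF picks medians])
    also have "\<dots> = 4 * ?N + 6 * s" by simp
    finally show ?thesis .
  qed

  have foreign: "(s + 1) * card (X \<inter> {a..b} \<times> {c..}) \<le> 2 * card (W \<inter> {a..b} \<times> {c..}) + 2 * (s + 1)"
    for a b c
  proof -
    let ?T = "{a..b} \<times> {c..}"
    let ?u = "s + 1 - ?r"
    have "?u * card (X \<inter> ?T) \<le> 1 * (card (W \<inter> ?T) + 2 * ?u)"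
    proof (rule separated_count[OF lv(2) fL, where a = a and b = b])
      show "X \<inter> ?T \<subseteq> \<Union>\<L>" using X(1) lv(1) by blast
      show "fst p \<in> {a..b}" if "p \<in> X \<inter> ?T" for p using that by (simp add: mem_Times_iff)
      show "finite (W \<inter> ?T)" using W(1) by simp
      show "card (X \<inter> ?T \<inter> L) \<le> 1" if "L \<in> \<L>" for L
      proof -
        have "card (X \<inter> ?T \<inter> L) \<le> card (X \<inter> L)" using finX by (intro card_mono) auto
        then show ?thesis using X(2)[OF that] by linarith
      qed
      show "?u \<le> card (L \<inter> (W \<inter> ?T))" if L: "L \<in> \<L>" "X \<inter> ?T \<inter> L \<noteq> {}" "fst ` L \<subseteq> {a..b}" for L
      proof -
        obtain x where "x \<in> X \<inter> ?T \<inter> L"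
          using L(2) unfolding ex_in_conv[symmetric] by (rule exE)
        then have x: "x \<in> X" "x \<in> ?T" "x \<in> L" by simp_all
        let ?B = "{q \<in> L. snd q < snd x}"
        have "card ?B < ?r" using X(3)[OF L(1)] x by (auto simp: lowest_def)
        moreover have "card (L - ?B) = card L - card ?B"
          using leaf(2)[OF L(1)] by (intro card_Diff_subset) auto
        moreover have "card (L - ?B) \<le> card (L \<inter> (W \<inter> ?T))"
        proof (rule card_mono)
          have "L - ?B \<subseteq> ?T"
          proof (rule subset_TimesI)
            show "fst ` (L - ?B) \<subseteq> {a..b}" using L(3) by blast
            have "c \<le> snd x" using x(2) by (simp add: mem_Times_iff)
            then show "snd ` (L - ?B) \<subseteq> {c..}" by (auto simp: not_less)
          qed
          then show "L - ?B \<subseteq> L \<inter> (W \<inter> ?T)" using leaf(1)[OF L(1)] by blast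
          show "finite (L \<inter> (W \<inter> ?T))" using W(1) by simp
        qed
        ultimately show ?thesis using lv(3)[OF L(1)] by linarith
      qed
    qed
    then show ?thesis by (intro rescale_count[of ?u]) auto
  qed
  show ?thesis using X(1) hit own foreign by blast
qed

section \<open>Reflection and strips of unit height\<close>

definition flip :: "point \<Rightarrow> point" where
  "flip p = (fst p, - snd p)"

lemma flip_simps [simp]: "fst (flip p) = fst p" "snd (flip p) = - snd p" "flip (flip p) = p"
  by (simp_all add: flip_def)

lemma inj_flip: "inj_on flip A"
  by (rule inj_on_inverseI[of _ flip]) simp

lemma flip_flip_image [simp]: "flip ` flip ` A = A"
  by (simp add: image_image)

lemma in_flip_image_iff: "p \<in> flip ` A \<longleftrightarrow> flip p \<in> A"
  by (metis flip_simps(3) image_iff)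

lemma flip_bottomless: "flip ` (A \<inter> {a..b} \<times> {..c}) = flip ` A \<inter> {a..b} \<times> {- c..}"
  by (auto simp: in_flip_image_iff mem_Times_iff set_eq_iff simp del: split_paired_All)

lemma flip_topless: "flip ` (A \<inter> {a..b} \<times> {c..}) = flip ` A \<inter> {a..b} \<times> {..- c}"
  by (auto simp: in_flip_image_iff mem_Times_iff set_eq_iff simp del: split_paired_All)

lemma card_flip: "card (flip ` A) = card A"
  by (rule card_image[OF inj_flip])

lemma card_flip_bottomless: "card (flip ` A \<inter> {a..b} \<times> {..c}) = card (A \<inter> {a..b} \<times> {- c..})"
  using card_flip[of "A \<inter> {a..b} \<times> {- c..}"] by (simp add: flip_topless)

lemma card_flip_topless: "card (flip ` A \<inter> {a..b} \<times> {c..}) = card (A \<inter> {a..b} \<times> {..- c})"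
  using card_flip[of "A \<inter> {a..b} \<times> {..- c}"] by (simp add: flip_bottomless)

lemma flip_inj_on:
  "inj_on fst W \<Longrightarrow> inj_on fst (flip ` W)" "inj_on snd W \<Longrightarrow> inj_on snd (flip ` W)"
  by (auto simp: inj_on_def)

lemma topless_transversal:
  fixes W :: "point set"
  assumes W: "finite W" "inj_on fst W" "inj_on snd W" and s: "0 < s"
  shows "\<exists>X \<subseteq> W.
    (\<forall>a b c. 4 * s - 3 \<le> card (W \<inter> {a..b} \<times> {c..}) \<longrightarrow> X \<inter> {a..b} \<times> {c..} \<noteq> {}) \<and>
    (\<forall>a b c. s * card (X \<inter> {a..b} \<times> {c..}) \<le> 4 * card (W \<inter> {a..b} \<times> {c..}) + 6 * s) \<and>
    (\<forall>a b c. (s + 1) * card (X \<inter> {a..b} \<times> {..c}) \<le> 2 * card (W \<inter> {a..b} \<times> {..c}) + 2 * (s + 1))"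
proof -
  obtain X where X: "X \<subseteq> flip ` W"
    "\<And>a b c. 4 * s - 3 \<le> card (flip ` W \<inter> {a..b} \<times> {..c}) \<Longrightarrow> X \<inter> {a..b} \<times> {..c} \<noteq> {}"
    "\<And>a b c. s * card (X \<inter> {a..b} \<times> {..c}) \<le> 4 * card (flip ` W \<inter> {a..b} \<times> {..c}) + 6 * s"
    "\<And>a b c. (s + 1) * card (X \<inter> {a..b} \<times> {c..}) \<le> 2 * card (flip ` W \<inter> {a..b} \<times> {c..}) + 2 * (s + 1)"
    using bottomless_transversal[of "flip ` W" s] W s flip_inj_on by blast
  let ?X = "flip ` X"
  have "?X \<subseteq> W" using image_mono[OF X(1), of flip] by simp
  moreover have "?X \<inter> {a..b} \<times> {c..} \<noteq> {}" if "4 * s - 3 \<le> card (W \<inter> {a..b} \<times> {c..})" for a b c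
  proof -
    have "X \<inter> {a..b} \<times> {..- c} \<noteq> {}" using that by (intro X(2)) (simp add: card_flip_bottomless)
    then have "flip ` (X \<inter> {a..b} \<times> {..- c}) \<noteq> {}" by simp
    then show ?thesis by (simp add: flip_bottomless)
  qed
  moreover have "s * card (?X \<inter> {a..b} \<times> {c..}) \<le> 4 * card (W \<inter> {a..b} \<times> {c..}) + 6 * s" for a b c
    using X(3)[of a b "- c"] by (simp add: card_flip_bottomless card_flip_topless)
  moreover have "(s + 1) * card (?X \<inter> {a..b} \<times> {..c}) \<le> 2 * card (W \<inter> {a..b} \<times> {..c}) + 2 * (s + 1)" for a b c
    using X(4)[of a b "- c"] by (simp add: card_flip_bottomless card_flip_topless)
  ultimately show ?thesis by blast
qed

lemma general_position_inj:
  "general_position V \<Longrightarrow> inj_on fst V" "general_position V \<Longrightarrow> inj_on snd V"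
  unfolding general_position_def inj_on_def by blast+

lemma general_position_subset: "general_position V \<Longrightarrow> U \<subseteq> V \<Longrightarrow> general_position U"
  unfolding general_position_def by blast

definition unit_strip :: "point set \<Rightarrow> int \<Rightarrow> point set" where
  "unit_strip V i = {p \<in> V. \<lfloor>snd p\<rfloor> = i}"

lemma unit_strip_subset: "unit_strip V i \<subseteq> V"
  by (auto simp: unit_strip_def)

lemma unit_height_lower:
  "unit_strip V \<lfloor>c\<rfloor> \<inter> {a..b} \<times> {c..c + 1} = unit_strip V \<lfloor>c\<rfloor> \<inter> {a..b} \<times> {c..}"
proof -
  have "snd p \<le> c + 1" if "\<lfloor>snd p\<rfloor> = \<lfloor>c\<rfloor>" for p :: point using that by linarith
  then show ?thesis by (auto simp: unit_strip_def)
qed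

lemma unit_height_upper:
  "unit_strip V (\<lfloor>c\<rfloor> + 1) \<inter> {a..b} \<times> {c..c + 1} = unit_strip V (\<lfloor>c\<rfloor> + 1) \<inter> {a..b} \<times> {..c + 1}"
proof -
  have "c \<le> snd p" if "\<lfloor>snd p\<rfloor> = \<lfloor>c\<rfloor> + 1" for p :: point using that by linarith
  then show ?thesis by (auto simp: unit_strip_def)
qed

lemma unit_height_strips:
  assumes "p \<in> {a..b} \<times> {c..c + 1}"
  shows "\<lfloor>snd p\<rfloor> = \<lfloor>c\<rfloor> \<or> \<lfloor>snd p\<rfloor> = \<lfloor>c\<rfloor> + 1"
proof -
  have "c \<le> snd p" "snd p \<le> c + 1" using assms by (auto simp: mem_Times_iff)
  then have "\<lfloor>c\<rfloor> \<le> \<lfloor>snd p\<rfloor>" "\<lfloor>snd p\<rfloor> \<le> \<lfloor>c + 1\<rfloor>" by (simp_all only: floor_mono)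
  then show ?thesis by simp linarith
qed

lemma unit_height_split:
  "V \<inter> {a..b} \<times> {c..c + 1} =
     unit_strip V \<lfloor>c\<rfloor> \<inter> {a..b} \<times> {c..} \<union> unit_strip V (\<lfloor>c\<rfloor> + 1) \<inter> {a..b} \<times> {..c + 1}"
proof -
  have "V \<inter> {a..b} \<times> {c..c + 1} = (unit_strip V \<lfloor>c\<rfloor> \<union> unit_strip V (\<lfloor>c\<rfloor> + 1)) \<inter> {a..b} \<times> {c..c + 1}"
    using unit_height_strips[of _ a b c] unfolding unit_strip_def by blast
  then show ?thesis unfolding Int_Un_distrib2 unit_height_lower unit_height_upper .
qed

lemma card_unit_height_split:
  assumes "finite V"
  shows "card (V \<inter> {a..b} \<times> {c..c + 1}) =
    card (unit_strip V \<lfloor>c\<rfloor> \<inter> {a..b} \<times> {c..}) + card (unit_strip V (\<lfloor>c\<rfloor> + 1) \<inter> {a..b} \<times> {..c + 1})"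
  unfolding unit_height_split using assms
  by (intro card_Un_disjoint) (auto simp: unit_strip_def)

text \<open>The union over all strips of the points chosen for bottomless and for topless ranges. In the
  notation of the proof, \<open>?own\<close> counts the chosen points whose kind of range matches the part of the rectangle
  that contains them.\<close>

lemma unit_height_shallow:
  assumes V: "finite V" "general_position V" and m: "0 < m"
  shows "\<exists>X. shallow_hitting_set 63 (range_hypergraph V unit_height_rectangles m) X"
proof -
  define s where "s = ((m + 1) div 2 + 3) div 4"
  have s: "0 < s" "4 * s - 3 \<le> (m + 1) div 2" "m \<le> 8 * s" using m unfolding s_def by linarith+
  have strip: "finite (unit_strip V i)" "inj_on fst (unit_strip V i)" "inj_on snd (unit_strip V i)" for i
    using V general_position_inj general_position_subset[OF V(2) unit_strip_subset]
      finite_subset[OF unit_strip_subset] by auto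
  obtain X where X: "\<And>i. X i \<subseteq> unit_strip V i"
    "\<And>i a b c. 4 * s - 3 \<le> card (unit_strip V i \<inter> {a..b} \<times> {..c}) \<Longrightarrow> X i \<inter> {a..b} \<times> {..c} \<noteq> {}"
    "\<And>i a b c. s * card (X i \<inter> {a..b} \<times> {..c}) \<le> 4 * card (unit_strip V i \<inter> {a..b} \<times> {..c}) + 6 * s"
    "\<And>i a b c. (s + 1) * card (X i \<inter> {a..b} \<times> {c..}) \<le> 2 * card (unit_strip V i \<inter> {a..b} \<times> {c..}) + 2 * (s + 1)"
    using bottomless_transversal[OF strip s(1)] by metis
  obtain Y where Y: "\<And>i. Y i \<subseteq> unit_strip V i"
    "\<And>i a b c. 4 * s - 3 \<le> card (unit_strip V i \<inter> {a..b} \<times> {c..}) \<Longrightarrow> Y i \<inter> {a..b} \<times> {c..} \<noteq> {}"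
    "\<And>i a b c. s * card (Y i \<inter> {a..b} \<times> {c..}) \<le> 4 * card (unit_strip V i \<inter> {a..b} \<times> {c..}) + 6 * s"
    "\<And>i a b c. (s + 1) * card (Y i \<inter> {a..b} \<times> {..c}) \<le> 2 * card (unit_strip V i \<inter> {a..b} \<times> {..c}) + 2 * (s + 1)"
    using topless_transversal[OF strip s(1)] by metis
  define Z where "Z = (\<Union>i. X i \<union> Y i)"
  have ZV: "Z \<subseteq> V" using X(1) Y(1) unit_strip_subset unfolding Z_def by blast
  have Z_strip: "unit_strip Z i = X i \<union> Y i" for i
    using X(1) Y(1) unfolding Z_def unit_strip_def by blast
  have "1 \<le> card (e \<inter> Z) \<and> card (e \<inter> Z) \<le> 63"
    if e: "e \<in> snd (range_hypergraph V unit_height_rectangles m)" for e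
  proof -
    obtain a b c where ce: "card e = m" and e: "e = V \<inter> {a..b} \<times> {c..c + 1}"
      using e unfolding range_hypergraph_def unit_height_rectangles_def by auto
    let ?i = "\<lfloor>c\<rfloor>" and ?j = "\<lfloor>c\<rfloor> + 1"
    let ?T = "{a..b} \<times> {c..}" and ?B = "{a..b} \<times> {..c + 1}"
    let ?t = "card (unit_strip V ?i \<inter> ?T)" and ?u = "card (unit_strip V ?j \<inter> ?B)"
    have tu: "?t + ?u = m" using ce card_unit_height_split[OF V(1)] unfolding e by simp
    have eZ: "e \<inter> Z = (X ?i \<inter> ?T \<union> Y ?i \<inter> ?T) \<union> (X ?j \<inter> ?B \<union> Y ?j \<inter> ?B)"
    proof -
      have "e \<inter> Z = Z \<inter> {a..b} \<times> {c..c + 1}" using ZV e by blast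
      then show ?thesis unfolding unit_height_split Z_strip by blast
    qed
    have fin: "finite (e \<inter> Z)" using V(1) e by simp
    have "4 * s - 3 \<le> ?t \<or> 4 * s - 3 \<le> ?u" using tu s(2) by linarith
    then have "Y ?i \<inter> ?T \<noteq> {} \<or> X ?j \<inter> ?B \<noteq> {}"
      using Y(2)[of ?i a b c] X(2)[of ?j a b "c + 1"] by linarith
    then have "e \<inter> Z \<noteq> {}" unfolding eZ by blast
    then have lower: "1 \<le> card (e \<inter> Z)" using fin by (simp add: Suc_le_eq card_gt_0_iff)
    let ?own = "card (Y ?i \<inter> ?T) + card (X ?j \<inter> ?B)"
    let ?foreign = "card (X ?i \<inter> ?T) + card (Y ?j \<inter> ?B)"
    have "s * ?own \<le> 4 * (?t + ?u) + 12 * s"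
      using Y(3)[of ?i a b c] X(3)[of ?j a b "c + 1"] by (simp add: distrib_left)
    also have "\<dots> \<le> s * 44" using tu s(3) by simp
    finally have own: "?own \<le> 44" using s(1) by simp
    have "(s + 1) * ?foreign \<le> 2 * (?t + ?u) + 4 * (s + 1)"
      using X(4)[of ?i a b c] Y(4)[of ?j a b "c + 1"] by (simp add: distrib_left)
    also have "\<dots> < (s + 1) * 20" using tu s(3) by simp
    finally have foreign: "?foreign < 20" by (simp only: mult_less_cancel1)
    have "card (e \<inter> Z) \<le> ?own + ?foreign"
      unfolding eZ
      using card_Un_le[of "X ?i \<inter> ?T \<union> Y ?i \<inter> ?T" "X ?j \<inter> ?B \<union> Y ?j \<inter> ?B"]
        card_Un_le[of "X ?i \<inter> ?T" "Y ?i \<inter> ?T"] card_Un_le[of "X ?j \<inter> ?B" "Y ?j \<inter> ?B"] by linarith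
    then show ?thesis using lower own foreign by linarith
  qed
  then show ?thesis
    using ZV unfolding shallow_hitting_set_def by (intro exI[of _ Z]) (simp add: range_hypergraph_def)
qed

section \<open>Polychromatic colourings for bottomless ranges\<close>

definition vertical :: "real \<Rightarrow> real \<Rightarrow> point set" where
  "vertical a b = {a..b} \<times> UNIV"

lemma in_vertical [simp]: "p \<in> vertical a b \<longleftrightarrow> a \<le> fst p \<and> fst p \<le> b"
  by (simp add: vertical_def mem_Times_iff)

text \<open>Colour \<open>0\<close> stands for uncoloured points. The count includes the two points \<open>u\<close> and \<open>v\<close>, so at least
  \<open>k - 1\<close> points lie between equally coloured points.\<close>

definition spaced :: "nat \<Rightarrow> point set \<Rightarrow> (point \<Rightarrow> nat) \<Rightarrow> bool" where
  "spaced k W f \<longleftrightarrow> (\<forall>u\<in>W. \<forall>v\<in>W. fst u < fst v \<longrightarrow> f u = f v \<longrightarrow> f u \<noteq> 0 \<longrightarrow>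
     k < card (W \<inter> vertical (fst u) (fst v)))"

definition extends :: "point set \<Rightarrow> (point \<Rightarrow> nat) \<Rightarrow> (point \<Rightarrow> nat) \<Rightarrow> bool" where
  "extends W g f \<longleftrightarrow> (\<forall>v\<in>W. f v \<noteq> 0 \<longrightarrow> g v = f v)"

lemma three_parts:
  assumes "finite A" "inj_on fst A" "card A = 3 * k - 2" "0 < k"
  obtains L M R where "A = L \<union> M \<union> R" "left_of L M" "left_of M R"
    "card L = k - 1" "card M = k" "card R = k - 1"
proof -
  have split: "\<exists>L R. A = L \<union> R \<and> left_of L R \<and> card L = n \<and> card R = card A - n"
    if A: "finite A" "inj_on fst A" "n \<le> card A" for A :: "point set" and n
  proof (intro exI conjI)
    let ?L = "lowest fst n A"
    have sub: "?L \<subseteq> A" by (rule lowest_subset)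
    then show "A = ?L \<union> (A - ?L)" by blast
    show "left_of ?L (A - ?L)"
      using lower_part_lowest[OF A(1), of fst n] unfolding left_of_def lower_part_def
      by (meson DiffD1 DiffD2 not_less)
    show "card ?L = n" using card_lowest[OF A(1,2)] A(3) by simp
    then show "card (A - ?L) = card A - n"
      using sub A(1) by (simp add: card_Diff_subset finite_subset)
  qed
  have "k - 1 \<le> card A" using assms(3,4) by linarith
  from split[OF assms(1,2) this]
  obtain L B where L: "A = L \<union> B" "left_of L B" "card L = k - 1" "card B = card A - (k - 1)"
    by blast
  have B: "finite B" "inj_on fst B" "k \<le> card B"
    using L assms inj_on_subset[OF assms(2)] by auto
  from split[OF B]
  obtain M R where M: "B = M \<union> R" "left_of M R" "card M = k" "card R = card B - k" by blast
  show thesis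
  proof (rule that)
    show "A = L \<union> M \<union> R" using L M by blast
    show "left_of L M" using L(2) M(1) by (auto simp: left_of_def)
    show "left_of M R" "card L = k - 1" "card M = k" using L M by simp_all
    show "card R = k - 1" using M(4) L(4) assms(3,4) by linarith
  qed
qed

text \<open>Two points of the same colour in \<open>M\<close> would have at least \<open>k + 1\<close> points in the interval that they
  span, and this interval is contained in \<open>M\<close>. Hence the colouring is injective on the coloured points of \<open>M\<close>, which has \<open>k\<close> points
  but only \<open>k - 1\<close> colours available.\<close>

lemma middle_uncolored:
  assumes A: "A = L \<union> M \<union> R" "left_of L M" "left_of M R" "A = W \<inter> vertical a b"
    and W: "finite W" "inj_on fst W" and M: "card M = k" and k: "0 < k"
    and f: "f ` W \<subseteq> {0..k}" "spaced k W f" and i: "i \<in> {1..k}" "\<And>v. v \<in> A \<Longrightarrow> f v \<noteq> i"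
  shows "\<exists>z\<in>M. f z = 0"
proof (rule ccontr)
  assume "\<not> ?thesis"
  then have col: "f z \<noteq> 0" if "z \<in> M" for z using that by auto
  have MW: "M \<subseteq> W" "finite M" using A(1,4) W(1) by (auto intro: finite_subset)
  have no: False if "u \<in> M" "v \<in> M" "f u = f v" "fst u < fst v" for u v
  proof -
    have "W \<inter> vertical (fst u) (fst v) \<subseteq> M"
    proof
      fix w assume w: "w \<in> W \<inter> vertical (fst u) (fst v)"
      have "u \<in> vertical a b" "v \<in> vertical a b" using that(1,2) A(1,4) by blast+
      then have "w \<in> A" using w A(4) by auto
      moreover have "w \<notin> L" using w that(1) A(2) by (force simp: left_of_def)
      moreover have "w \<notin> R" using w that(2) A(3) by (force simp: left_of_def)
      ultimately show "w \<in> M" using A(1) by blast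
    qed
    then have "card (W \<inter> vertical (fst u) (fst v)) \<le> k"
      using MW(2) M card_mono by metis
    moreover have "k < card (W \<inter> vertical (fst u) (fst v))"
      using f(2) that MW(1) col[of u] unfolding spaced_def by blast
    ultimately show False by linarith
  qed
  have "inj_on f M"
  proof (rule inj_onI)
    fix u v assume uv: "u \<in> M" "v \<in> M" "f u = f v"
    then have "\<not> fst u < fst v" "\<not> fst v < fst u" using no[of u v] no[of v u] by auto
    then have "fst u = fst v" by linarith
    then show "u = v" using W(2) MW(1) uv unfolding inj_on_def by blast
  qed
  moreover have "f ` M \<subseteq> {1..k} - {i}"
  proof
    fix j assume "j \<in> f ` M"
    then obtain z where z: "z \<in> M" "j = f z" by blast
    have "f z \<le> k" using f(1) z(1) MW(1) by (meson atLeastAtMost_iff image_subset_iff subsetD)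
    moreover have "f z \<noteq> i" using i(2) z(1) A(1) by blast
    ultimately show "j \<in> {1..k} - {i}" using col[OF z(1)] z(2) by simp
  qed
  ultimately have "k \<le> card ({1..k} - {i})"
    using M card_image[of f M] card_mono[of "{1..k} - {i}" "f ` M"] by simp
  moreover have "card ({1..k} - {i}) = k - 1" using i(1) by simp
  ultimately show False using k by linarith
qed

text \<open>Before \<open>p\<close> was inserted every interval of \<open>3 * k - 2\<close> points had colour \<open>i\<close>. So an interval with that
  many points that misses the colour contains \<open>p\<close>, and it has exactly \<open>3 * k - 2\<close> points. All such intervals
  are repaired by colouring one middle point \<open>z\<close> of one of them: if another one did not contain \<open>z\<close>, then
  the union of the two, which is an interval as both contain \<open>p\<close>, would be an interval without colour \<open>i\<close>
  that has more than \<open>3 * k - 2\<close> points. Since \<open>z\<close> has \<open>k - 1\<close> points of the repaired interval on either side,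
  there are enough points between \<open>z\<close> and the other points of colour \<open>i\<close>.\<close>

lemma color_once:
  assumes W: "finite W" "inj_on fst W" and k: "0 < k" and i: "i \<in> {1..k}"
    and f: "f ` W \<subseteq> {0..k}" "spaced k W f"
    and old: "\<And>a b. 3 * k - 2 \<le> card ((W - {p}) \<inter> vertical a b) \<Longrightarrow> i \<in> f ` (W \<inter> vertical a b)"
  shows "\<exists>g. g ` W \<subseteq> {0..k} \<and> spaced k W g \<and> extends W g f \<and>
    (\<forall>a b. 3 * k - 2 \<le> card (W \<inter> vertical a b) \<longrightarrow> i \<in> g ` (W \<inter> vertical a b))"
proof (cases "\<forall>a b. 3 * k - 2 \<le> card (W \<inter> vertical a b) \<longrightarrow> i \<in> f ` (W \<inter> vertical a b)")
  case True
  then show ?thesis using f by (intro exI[of _ f]) (auto simp: extends_def)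
next
  case False
  then obtain a b where ab: "3 * k - 2 \<le> card (W \<inter> vertical a b)"
    "\<And>v. v \<in> W \<inter> vertical a b \<Longrightarrow> f v \<noteq> i" by blast
  have free: "card (W \<inter> vertical a b) = 3 * k - 2 \<and> p \<in> vertical a b"
    if "3 * k - 2 \<le> card (W \<inter> vertical a b)" "\<And>v. v \<in> W \<inter> vertical a b \<Longrightarrow> f v \<noteq> i" for a b
  proof -
    have lt: "card ((W - {p}) \<inter> vertical a b) < 3 * k - 2"
    proof (rule ccontr)
      assume "\<not> ?thesis"
      then have "i \<in> f ` (W \<inter> vertical a b)" using old[of a b] by simp
      then obtain v where "i = f v" "v \<in> W \<inter> vertical a b" by (rule imageE)
      then show False using that(2)[of v] by simp
    qed
    have "W \<inter> vertical a b \<subseteq> insert p ((W - {p}) \<inter> vertical a b)" by blast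
    then have "card (W \<inter> vertical a b) \<le> card (insert p ((W - {p}) \<inter> vertical a b))"
      using W(1) by (intro card_mono) auto
    also have "\<dots> \<le> Suc (card ((W - {p}) \<inter> vertical a b))" by (rule card_insert_le_m1) auto
    finally have "card (W \<inter> vertical a b) = 3 * k - 2" using lt that(1) by linarith
    moreover have "p \<in> vertical a b"
    proof (rule ccontr)
      assume "p \<notin> vertical a b"
      then have "(W - {p}) \<inter> vertical a b = W \<inter> vertical a b" by blast
      then show False using lt that(1) by simp
    qed
    ultimately show ?thesis by blast
  qed
  have cardA: "card (W \<inter> vertical a b) = 3 * k - 2" and pA: "p \<in> vertical a b"
    using free[OF ab] by blast+
  obtain L M R where A: "W \<inter> vertical a b = L \<union> M \<union> R" "left_of L M" "left_of M R"
    "card L = k - 1" "card M = k" "card R = k - 1"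
    using three_parts[of "W \<inter> vertical a b" k] W cardA k inj_on_subset[OF W(2), of "W \<inter> vertical a b"]
    by auto
  obtain z where z: "z \<in> M" "f z = 0"
    using middle_uncolored[OF A(1,2,3) refl W A(5) k f i ab(2)] by blast
  have zW: "z \<in> W" "z \<in> vertical a b" using z(1) A(1) by blast+
  have finA: "finite L" "finite R" using W(1) A(1) by (metis finite_Int finite_Un)+
  let ?g = "f(z := i)"
  have far: "k < card (W \<inter> vertical (fst u) (fst v))"
    if uv: "u \<in> W" "v \<in> W" "fst u < fst v" "u = z \<and> f v = i \<or> v = z \<and> f u = i" for u v
  proof -
    have part: "k < card (W \<inter> vertical (fst u) (fst v))"
      if S: "S \<subseteq> W \<inter> vertical (fst u) (fst v)" "card S = k - 1" "finite S" "u \<notin> S" "v \<notin> S" for S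
    proof -
      have "insert u (insert v S) \<subseteq> W \<inter> vertical (fst u) (fst v)" using S(1) uv(1-3) by auto
      then have "card (insert u (insert v S)) \<le> card (W \<inter> vertical (fst u) (fst v))"
        using W(1) by (intro card_mono) auto
      moreover have "u \<noteq> v" using uv(3) by blast
      ultimately show ?thesis using S k by simp
    qed
    from uv(4) show ?thesis
    proof
      assume uz: "u = z \<and> f v = i"
      then have "v \<notin> W \<inter> vertical a b" using ab(2) by blast
      then have v: "b < fst v" using uv zW(2) uz by auto
      have "R \<subseteq> W \<inter> vertical (fst u) (fst v)"
      proof
        fix w assume w: "w \<in> R"
        then have "fst z < fst w" using A(3) z(1) by (simp add: left_of_def)
        moreover have "w \<in> W \<inter> vertical a b" using w A(1) by blast
        ultimately show "w \<in> W \<inter> vertical (fst u) (fst v)" using uz v by auto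
      qed
      moreover have "u \<notin> R" using A(3) z(1) uz unfolding left_of_def by blast
      moreover have "v \<notin> R" using \<open>v \<notin> W \<inter> vertical a b\<close> A(1) by blast
      ultimately show ?thesis using A(6) finA(2) by (intro part)
    next
      assume vz: "v = z \<and> f u = i"
      then have "u \<notin> W \<inter> vertical a b" using ab(2) by blast
      then have u: "fst u < a" using uv zW(2) vz by auto
      have "L \<subseteq> W \<inter> vertical (fst u) (fst v)"
      proof
        fix w assume w: "w \<in> L"
        then have "fst w < fst z" using A(2) z(1) by (simp add: left_of_def)
        moreover have "w \<in> W \<inter> vertical a b" using w A(1) by blast
        ultimately show "w \<in> W \<inter> vertical (fst u) (fst v)" using vz u by auto
      qed
      moreover have "v \<notin> L" using A(2) z(1) vz unfolding left_of_def by blast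
      moreover have "u \<notin> L" using \<open>u \<notin> W \<inter> vertical a b\<close> A(1) by blast
      ultimately show ?thesis using A(4) finA(1) by (intro part)
    qed
  qed
  have "?g ` W \<subseteq> {0..k}" using f(1) i by auto
  moreover have "spaced k W ?g"
    unfolding spaced_def
  proof (intro ballI impI)
    fix u v assume uv: "u \<in> W" "v \<in> W" "fst u < fst v" "?g u = ?g v" "?g u \<noteq> 0"
    have "u \<noteq> v" using uv(3) by blast
    then consider "u = z" "f v = i" | "v = z" "f u = i" | "u \<noteq> z" "v \<noteq> z"
      using uv(4) by (auto split: if_splits)
    then show "k < card (W \<inter> vertical (fst u) (fst v))"
    proof cases
      case 3
      then show ?thesis using f(2) uv unfolding spaced_def by simp
    qed (use far[OF uv(1-3)] in blast)+
  qed
  moreover have "extends W ?g f" using z(2) by (simp add: extends_def)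
  moreover have "i \<in> ?g ` (W \<inter> vertical a' b')" if big: "3 * k - 2 \<le> card (W \<inter> vertical a' b')" for a' b'
  proof (rule ccontr)
    assume un: "\<not> ?thesis"
    then have nz: "z \<notin> vertical a' b'" using zW(1) by (metis IntI fun_upd_same image_eqI)
    have no: "f v \<noteq> i" if "v \<in> W \<inter> vertical a' b'" for v
      using un that nz by (metis IntD2 fun_upd_other image_eqI)
    have pA': "p \<in> vertical a' b'" using free[OF big no] by blast
    have union: "vertical (min a a') (max b b') \<subseteq> vertical a b \<union> vertical a' b'"
      using pA pA' by (auto simp: min_def max_def split: if_splits)
    let ?U = "W \<inter> vertical (min a a') (max b b')"
    have sub: "W \<inter> vertical a b \<subseteq> ?U" "W \<inter> vertical a' b' \<subseteq> ?U" by auto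
    have finU: "finite ?U" using W(1) by simp
    have "3 * k - 2 \<le> card ?U" using card_mono[OF finU sub(1)] cardA by simp
    moreover have "f v \<noteq> i" if "v \<in> ?U" for v
      using that ab(2)[of v] no[of v] union by blast
    ultimately have "card ?U = 3 * k - 2" using free by blast
    then have "W \<inter> vertical a' b' = ?U"
      using card_mono[OF finU sub(2)] big sub(2) finU by (intro card_subset_eq) auto
    moreover have "z \<in> ?U" using zW sub(1) by blast
    ultimately show False using nz by blast
  qed
  ultimately show ?thesis by blast
qed

lemma extends_trans: "extends W h g \<Longrightarrow> extends W g f \<Longrightarrow> extends W h f"
  unfolding extends_def by metis

lemma extends_image:
  assumes "extends W g f" "S \<subseteq> W" "i \<in> f ` S" "i \<noteq> 0"
  shows "i \<in> g ` S"
proof -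
  obtain v where v: "i = f v" "v \<in> S" using assms(3) by (rule imageE)
  then have "g v = i" using assms(1,2,4) unfolding extends_def by auto
  then show ?thesis using v(2) by (intro image_eqI[of _ _ v]) simp_all
qed

text \<open>The colours are treated one after the other. A step only colours uncoloured points, hence it
  does not spoil what was achieved for earlier colours.\<close>

lemma color_all:
  assumes W: "finite W" "inj_on fst W" and k: "0 < k"
    and f: "f ` W \<subseteq> {0..k}" "spaced k W f"
    and old: "\<And>a b. 3 * k - 2 \<le> card ((W - {p}) \<inter> vertical a b) \<Longrightarrow> {1..k} \<subseteq> f ` (W \<inter> vertical a b)"
    and j: "j \<le> k"
  shows "\<exists>g. g ` W \<subseteq> {0..k} \<and> spaced k W g \<and> extends W g f \<and>
    (\<forall>a b. 3 * k - 2 \<le> card (W \<inter> vertical a b) \<longrightarrow> {1..j} \<subseteq> g ` (W \<inter> vertical a b))"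
  using j
proof (induction j)
  case 0
  then show ?case using f by (intro exI[of _ f]) (auto simp: extends_def)
next
  case (Suc j)
  then obtain g where g: "g ` W \<subseteq> {0..k}" "spaced k W g" "extends W g f"
    "\<forall>a b. 3 * k - 2 \<le> card (W \<inter> vertical a b) \<longrightarrow> {1..j} \<subseteq> g ` (W \<inter> vertical a b)"
    by auto
  have i: "Suc j \<in> {1..k}" using Suc.prems by simp
  have "Suc j \<in> g ` (W \<inter> vertical a b)" if "3 * k - 2 \<le> card ((W - {p}) \<inter> vertical a b)" for a b
    using extends_image[OF g(3), of "W \<inter> vertical a b" "Suc j"] old[OF that] i by blast
  from color_once[OF W k i g(1,2) this]
  obtain h where h: "h ` W \<subseteq> {0..k}" "spaced k W h" "extends W h g"
    "\<forall>a b. 3 * k - 2 \<le> card (W \<inter> vertical a b) \<longrightarrow> Suc j \<in> h ` (W \<inter> vertical a b)"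
    by metis
  have "{1..Suc j} \<subseteq> h ` (W \<inter> vertical a b)" if big: "3 * k - 2 \<le> card (W \<inter> vertical a b)" for a b
  proof
    fix i assume i: "i \<in> {1..Suc j}"
    show "i \<in> h ` (W \<inter> vertical a b)"
    proof (cases "i = Suc j")
      case True
      then show ?thesis using h(4) big by simp
    next
      case False
      then have "i \<in> {1..j}" "i \<noteq> 0" using i by auto
      then show ?thesis using g(4) big extends_image[OF h(3), of "W \<inter> vertical a b" i] by blast
    qed
  qed
  then show ?case using h extends_trans[OF h(3) g(3)] by blast
qed

text \<open>Induction over the points from bottom to top. A bottomless range below the new point is a range of
  the old set and stays polychromatic because colours are never changed; a range that reaches the
  new point contains all points of its slab.\<close>

lemma partial_coloring:
  assumes W: "finite W" "inj_on fst W" "inj_on snd W" and k: "0 < k"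
  shows "\<exists>f. f ` W \<subseteq> {0..k} \<and> spaced k W f \<and>
    (\<forall>a b c. 3 * k - 2 \<le> card (W \<inter> {a..b} \<times> {..c}) \<longrightarrow> {1..k} \<subseteq> f ` (W \<inter> {a..b} \<times> {..c}))"
  using W
proof (induction W rule: finite_ranking_induct[where f = snd])
  case empty
  have "\<not> 3 * k - 2 \<le> 0" using k by linarith
  then show ?case by (intro exI[of _ "\<lambda>_. 0"]) (simp add: spaced_def)
next
  case (insert p S)
  have inj: "inj_on fst S" "inj_on snd S" using insert.prems inj_on_subset by blast+
  show ?case
  proof (cases "p \<in> S")
    case True
    then show ?thesis using insert.IH inj by (simp add: insert_absorb)
  next
    case False
    let ?W = "insert p S"
    obtain f where f: "f ` S \<subseteq> {0..k}" "spaced k S f"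
      "\<forall>a b c. 3 * k - 2 \<le> card (S \<inter> {a..b} \<times> {..c}) \<longrightarrow> {1..k} \<subseteq> f ` (S \<inter> {a..b} \<times> {..c})"
      using insert.IH[OF inj] by metis
    let ?f = "f(p := 0)"
    have same: "?f ` T = f ` T" if "T \<subseteq> S" for T
      using that False by (intro image_cong) auto
    have below: "S \<inter> {a..b} \<times> {..snd p} = S \<inter> vertical a b" for a b
      using insert.hyps(2) by (auto simp: vertical_def)
    have finW: "finite ?W" using insert.hyps(1) by simp
    have f0: "?f ` ?W \<subseteq> {0..k}" using f(1) by auto
    have sp: "spaced k ?W ?f"
      unfolding spaced_def
    proof (intro ballI impI)
      fix u v assume uv: "u \<in> ?W" "v \<in> ?W" "fst u < fst v" "?f u = ?f v" "?f u \<noteq> 0"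
      then have "u \<noteq> p" "v \<noteq> p" by (auto split: if_splits)
      then have "k < card (S \<inter> vertical (fst u) (fst v))"
        using f(2) uv unfolding spaced_def by simp
      also have "\<dots> \<le> card (?W \<inter> vertical (fst u) (fst v))"
        using finW by (intro card_mono) auto
      finally show "k < card (?W \<inter> vertical (fst u) (fst v))" .
    qed
    have old: "{1..k} \<subseteq> ?f ` (?W \<inter> vertical a b)"
      if "3 * k - 2 \<le> card ((?W - {p}) \<inter> vertical a b)" for a b
    proof -
      have "?W - {p} = S" using False by simp
      then have "{1..k} \<subseteq> f ` (S \<inter> vertical a b)"
        using f(3)[rule_format, of a b "snd p"] that unfolding below by simp
      also have "\<dots> = ?f ` (S \<inter> vertical a b)" using same by simp
      also have "\<dots> \<subseteq> ?f ` (?W \<inter> vertical a b)" by blast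
      finally show ?thesis .
    qed
    obtain g where g: "g ` ?W \<subseteq> {0..k}" "spaced k ?W g" "extends ?W g ?f"
      "\<forall>a b. 3 * k - 2 \<le> card (?W \<inter> vertical a b) \<longrightarrow> {1..k} \<subseteq> g ` (?W \<inter> vertical a b)"
      using color_all[OF finW insert.prems(1) k f0 sp old order_refl] by metis
    have "{1..k} \<subseteq> g ` (?W \<inter> {a..b} \<times> {..c})"
      if big: "3 * k - 2 \<le> card (?W \<inter> {a..b} \<times> {..c})" for a b c
    proof (cases "snd p \<le> c")
      case True
      then have "snd q \<le> c" if "q \<in> ?W" for q
        using that insert.hyps(2)[of q] by auto
      then have "q \<in> {a..b} \<times> {..c} \<longleftrightarrow> q \<in> vertical a b" if "q \<in> ?W" for q
        using that by (simp add: mem_Times_iff)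
      then have "?W \<inter> {a..b} \<times> {..c} = ?W \<inter> vertical a b" by blast
      then show ?thesis using g(4) big by simp
    next
      case below_p: False
      then have eq: "?W \<inter> {a..b} \<times> {..c} = S \<inter> {a..b} \<times> {..c}" by (auto simp: mem_Times_iff)
      have "{1..k} \<subseteq> f ` (S \<inter> {a..b} \<times> {..c})" using f(3) big unfolding eq by blast
      then have "{1..k} \<subseteq> ?f ` (S \<inter> {a..b} \<times> {..c})" using same by simp
      moreover have "i \<in> g ` (S \<inter> {a..b} \<times> {..c})" if "i \<in> ?f ` (S \<inter> {a..b} \<times> {..c})" "i \<in> {1..k}" for i
        using that by (intro extends_image[OF g(3)]) auto
      ultimately show ?thesis unfolding eq by blast
    qed
    then show ?thesis using g(1,2) by (intro exI[of _ g]) simp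
  qed
qed

lemma bottomless_coloring:
  fixes W :: "point set"
  assumes "finite W" "inj_on fst W" "inj_on snd W" "0 < k"
  shows "\<exists>h. h ` W \<subseteq> {1..k} \<and>
    (\<forall>a b c. 3 * k - 2 \<le> card (W \<inter> {a..b} \<times> {..c}) \<longrightarrow> {1..k} \<subseteq> h ` (W \<inter> {a..b} \<times> {..c}))"
proof -
  obtain f where f: "f ` W \<subseteq> {0..k}"
    "\<forall>a b c. 3 * k - 2 \<le> card (W \<inter> {a..b} \<times> {..c}) \<longrightarrow> {1..k} \<subseteq> f ` (W \<inter> {a..b} \<times> {..c})"
    using partial_coloring[OF assms] by metis
  let ?h = "\<lambda>v. if f v = 0 then 1 else f v"
  have "?h ` W \<subseteq> {1..k}" using f(1) assms(4) by (auto simp: Suc_le_eq)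
  moreover have "{1..k} \<subseteq> ?h ` S" if S: "{1..k} \<subseteq> f ` S" for S
  proof
    fix i assume i: "i \<in> {1..k}"
    then obtain v where "v \<in> S" "i = f v" using S by blast
    then show "i \<in> ?h ` S" using i by (intro image_eqI[of _ _ v]) auto
  qed
  ultimately show ?thesis using f(2) by (intro exI[of _ ?h]) simp
qed

lemma topless_coloring:
  fixes W :: "point set"
  assumes "finite W" "inj_on fst W" "inj_on snd W" "0 < k"
  shows "\<exists>h. h ` W \<subseteq> {1..k} \<and>
    (\<forall>a b c. 3 * k - 2 \<le> card (W \<inter> {a..b} \<times> {c..}) \<longrightarrow> {1..k} \<subseteq> h ` (W \<inter> {a..b} \<times> {c..}))"
proof -
  obtain h where h: "h ` flip ` W \<subseteq> {1..k}"
    "\<forall>a b c. 3 * k - 2 \<le> card (flip ` W \<inter> {a..b} \<times> {..c}) \<longrightarrow> {1..k} \<subseteq> h ` (flip ` W \<inter> {a..b} \<times> {..c})"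
    using bottomless_coloring[OF _ flip_inj_on(1)[OF assms(2)] flip_inj_on(2)[OF assms(3)] assms(4)]
      assms(1) by (metis finite_imageI)
  have "{1..k} \<subseteq> (h \<circ> flip) ` (W \<inter> {a..b} \<times> {c..})"
    if "3 * k - 2 \<le> card (W \<inter> {a..b} \<times> {c..})" for a b c
  proof -
    have "3 * k - 2 \<le> card (flip ` W \<inter> {a..b} \<times> {..- c})"
      using that by (simp add: card_flip_bottomless)
    then have "{1..k} \<subseteq> h ` (flip ` W \<inter> {a..b} \<times> {..- c})" using h(2) by blast
    then show ?thesis unfolding flip_topless[symmetric] by (simp add: image_comp)
  qed
  moreover have "(h \<circ> flip) ` W \<subseteq> {1..k}" using h(1) by (simp add: image_comp)
  ultimately show ?thesis by blast
qed

section \<open>Serving bottomless and topless ranges simultaneously\<close>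

lemma pair_partition:
  assumes "finite W" "inj_on fst W" "even (card W)"
  shows "\<exists>\<Q>. separated \<Q> \<and> \<Union>\<Q> = W \<and> (\<forall>Q\<in>\<Q>. card Q = 2)"
  using assms
proof (induction "card W" arbitrary: W rule: less_induct)
  case less
  show ?case
  proof (cases "W = {}")
    case True
    then show ?thesis by (intro exI[of _ "{}"]) (simp add: separated_def)
  next
    case False
    then have "card W \<noteq> 0" using less.prems by simp
    then have two: "2 \<le> card W" using less.prems(3) by (metis dvd_imp_le gr0I)
    let ?Q = "lowest fst 2 W"
    let ?V = "W - ?Q"
    have Q: "?Q \<subseteq> W" "card ?Q = 2"
      using card_lowest[OF less.prems(1,2), of 2] two by (simp_all add: lowest_subset)
    have V: "card ?V = card W - 2" using Q less.prems(1) by (simp add: card_Diff_subset finite_subset)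
    have "\<exists>\<Q>. separated \<Q> \<and> \<Union>\<Q> = ?V \<and> (\<forall>Q\<in>\<Q>. card Q = 2)"
    proof (rule less.hyps)
      show "card ?V < card W" "even (card ?V)" using V two less.prems(3) by auto
      show "finite ?V" "inj_on fst ?V" using less.prems(1,2) inj_on_subset by blast+
    qed
    then obtain \<Q> where \<Q>: "separated \<Q>" "\<Union>\<Q> = ?V" "\<forall>Q\<in>\<Q>. card Q = 2" by blast
    have "left_of ?Q ?V"
      using lower_part_lowest[OF less.prems(1), of fst 2] unfolding left_of_def lower_part_def
      by (meson DiffD1 DiffD2 not_less)
    then have "separated ({?Q} \<union> \<Q>)"
      using \<Q>(1,2) by (intro separated_Un) (simp_all add: separated_def)
    then show ?thesis using \<Q> Q by (intro exI[of _ "{?Q} \<union> \<Q>"]) auto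
  qed
qed

text \<open>\<open>R\<close> consists of the lower point of each pair of neighbours in the order by \<open>x\<close>. Only the two pairs
  that the sides of a range cut apart can be represented by the wrong point alone.\<close>

lemma balanced_halves_even:
  fixes W :: "point set"
  assumes W: "finite W" "inj_on fst W" "inj_on snd W" "even (card W)"
  shows "\<exists>R \<subseteq> W. \<forall>a b c.
    card ((W - R) \<inter> {a..b} \<times> {..c}) \<le> card (R \<inter> {a..b} \<times> {..c}) + 2 \<and>
    card (R \<inter> {a..b} \<times> {c..}) \<le> card ((W - R) \<inter> {a..b} \<times> {c..}) + 2"
proof -
  obtain \<Q> where \<Q>: "separated \<Q>" "\<Union>\<Q> = W" "\<And>Q. Q \<in> \<Q> \<Longrightarrow> card Q = 2"
    using pair_partition[OF W(1,2,4)] by blast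
  have fQ: "finite \<Q>" using finite_UnionD[of \<Q>] \<Q>(2) W(1) by simp
  define R where "R = {p \<in> W. \<forall>Q\<in>\<Q>. p \<in> Q \<longrightarrow> (\<forall>q\<in>Q. snd p \<le> snd q)}"
  have RW: "R \<subseteq> W" unfolding R_def by blast
  have pair: "\<exists>r t. Q = {r, t} \<and> r \<in> R \<and> t \<in> W - R \<and> snd r < snd t" if Q: "Q \<in> \<Q>" for Q
  proof -
    obtain x y where xy: "Q = {x, y}" "x \<noteq> y" using \<Q>(3)[OF Q] by (meson card_2_iff)
    have "x \<in> W" "y \<in> W" using Q \<Q>(2) xy(1) by blast+
    then have "snd x \<noteq> snd y" using W(3) xy(2) unfolding inj_on_def by blast
    have key: "\<exists>r t. Q = {r, t} \<and> r \<in> R \<and> t \<in> W - R \<and> snd r < snd t"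
      if rt: "Q = {r, t}" "snd r < snd t" for r t
    proof (intro exI conjI)
      have rtW: "r \<in> W" "t \<in> W" using Q \<Q>(2) rt(1) by blast+
      have "snd r \<le> snd q" if "Q' \<in> \<Q>" "r \<in> Q'" "q \<in> Q'" for Q' q
      proof -
        have "Q' = Q" by (rule separated_disjoint[OF \<Q>(1) that(1) Q that(2)]) (simp add: rt(1))
        then show ?thesis using that(3) rt by auto
      qed
      then show "r \<in> R" using rtW(1) unfolding R_def by simp
      have "t \<notin> R"
      proof
        assume "t \<in> R"
        then have "snd t \<le> snd r" using Q rt(1) unfolding R_def by simp
        then show False using rt(2) by simp
      qed
      then show "t \<in> W - R" using rtW(2) by blast
    qed (use rt in auto)
    consider "snd x < snd y" | "snd y < snd x" using \<open>snd x \<noteq> snd y\<close> by linarith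
    then show ?thesis
    proof cases
      case 1
      then show ?thesis by (rule key[OF xy(1)])
    next
      case 2
      have "Q = {y, x}" using xy(1) by blast
      then show ?thesis using 2 by (rule key)
    qed
  qed
  have one: "card (S \<inter> Q) \<le> 1" if Q: "Q \<in> \<Q>" and S: "S \<inter> R = {} \<or> S \<subseteq> R" for Q S
  proof -
    obtain r t where rt: "Q = {r, t}" "r \<in> R" "t \<in> W - R" using pair[OF Q] by blast
    then have "S \<inter> Q \<subseteq> {t} \<or> S \<inter> Q \<subseteq> {r}" using S by blast
    then have "\<exists>x. S \<inter> Q \<subseteq> {x}" by blast
    then obtain x where "S \<inter> Q \<subseteq> {x}" ..
    then have "card (S \<inter> Q) \<le> card {x}" by (intro card_mono) simp_all
    then show ?thesis by simp
  qed
  have inside: "p \<in> {a..b} \<times> S" if "fst ` Q \<subseteq> {a..b}" "p \<in> Q" "snd p \<in> S" for p Q a b and S :: "real set"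
  proof -
    have "fst p \<in> {a..b}" using that(1,2) by blast
    then show ?thesis using that(3) by (simp add: mem_Times_iff)
  qed
  have selected: "y \<in> T" if "S \<inter> T \<inter> Q \<noteq> {}" "Q = {x, y}" "x \<notin> S" for S T Q and x y :: point
    using that by blast
  have nonempty: "1 \<le> card S" if "p \<in> S" "finite S" for p and S :: "point set"
    using that card_gt_0_iff[of S] by (auto simp: Suc_le_eq)
  have "1 * card ((W - R) \<inter> {a..b} \<times> {..c}) \<le> 1 * (card (R \<inter> {a..b} \<times> {..c}) + 2 * 1)" for a b c
  proof (rule separated_count[OF \<Q>(1) fQ, where a = a and b = b])
    show "(W - R) \<inter> {a..b} \<times> {..c} \<subseteq> \<Union>\<Q>" using \<Q>(2) by blast
    show "fst p \<in> {a..b}" if "p \<in> (W - R) \<inter> {a..b} \<times> {..c}" for p using that by (simp add: mem_Times_iff)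
    show "card ((W - R) \<inter> {a..b} \<times> {..c} \<inter> Q) \<le> 1" if "Q \<in> \<Q>" for Q using that by (intro one) blast+
    show "finite (R \<inter> {a..b} \<times> {..c})" using W(1) RW by (simp add: finite_subset)
    show "1 \<le> card (Q \<inter> (R \<inter> {a..b} \<times> {..c}))"
      if Q: "Q \<in> \<Q>" "(W - R) \<inter> {a..b} \<times> {..c} \<inter> Q \<noteq> {}" "fst ` Q \<subseteq> {a..b}" for Q
    proof -
      obtain r t where rt: "Q = {r, t}" "r \<in> R" "t \<in> W - R" "snd r < snd t" using pair[OF Q(1)] by blast
      have "t \<in> {a..b} \<times> {..c}" by (rule selected[OF Q(2) rt(1)]) (use rt(2) in blast)
      then have "snd r \<in> {..c}" using rt(4) by (simp add: mem_Times_iff)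
      then have "r \<in> {a..b} \<times> {..c}" by (intro inside[OF Q(3)]) (simp_all add: rt(1))
      then show ?thesis using rt(1,2) by (intro nonempty[of r]) simp_all
    qed
  qed
  moreover have "1 * card (R \<inter> {a..b} \<times> {c..}) \<le> 1 * (card ((W - R) \<inter> {a..b} \<times> {c..}) + 2 * 1)" for a b c
  proof (rule separated_count[OF \<Q>(1) fQ, where a = a and b = b])
    show "R \<inter> {a..b} \<times> {c..} \<subseteq> \<Union>\<Q>" using \<Q>(2) RW by blast
    show "fst p \<in> {a..b}" if "p \<in> R \<inter> {a..b} \<times> {c..}" for p using that by (simp add: mem_Times_iff)
    show "card (R \<inter> {a..b} \<times> {c..} \<inter> Q) \<le> 1" if "Q \<in> \<Q>" for Q using that by (intro one) blast+
    show "finite ((W - R) \<inter> {a..b} \<times> {c..})" using W(1) by simp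
    show "1 \<le> card (Q \<inter> ((W - R) \<inter> {a..b} \<times> {c..}))"
      if Q: "Q \<in> \<Q>" "R \<inter> {a..b} \<times> {c..} \<inter> Q \<noteq> {}" "fst ` Q \<subseteq> {a..b}" for Q
    proof -
      obtain r t where rt: "Q = {r, t}" "r \<in> R" "t \<in> W - R" "snd r < snd t" using pair[OF Q(1)] by blast
      have "Q = {t, r}" using rt(1) by blast
      from selected[OF Q(2) this] have "r \<in> {a..b} \<times> {c..}" using rt(3) by blast
      then have "snd t \<in> {c..}" using rt(4) by (simp add: mem_Times_iff)
      then have "t \<in> {a..b} \<times> {c..}" by (intro inside[OF Q(3)]) (simp_all add: rt(1))
      then show ?thesis using rt(1,3) by (intro nonempty[of t]) simp_all
    qed
  qed
  ultimately show ?thesis using RW by (intro exI[of _ R]) simp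
qed

text \<open>If the number of points is odd, a dummy point \<open>d\<close> to the right of all others completes the last
  pair. It does no harm, because a range can be clipped at its right side without losing other points.\<close>

lemma balanced_halves:
  fixes W :: "point set"
  assumes W: "finite W" "inj_on fst W" "inj_on snd W"
  shows "\<exists>R \<subseteq> W. \<forall>a b c.
    card ((W - R) \<inter> {a..b} \<times> {..c}) \<le> card (R \<inter> {a..b} \<times> {..c}) + 2 \<and>
    card (R \<inter> {a..b} \<times> {c..}) \<le> card ((W - R) \<inter> {a..b} \<times> {c..}) + 2"
proof (cases "even (card W)")
  case True
  then show ?thesis by (rule balanced_halves_even[OF W])
next
  case False
  then have "W \<noteq> {}" by auto
  define x where "x = Max (fst ` W)"
  have x: "fst p \<le> x" if "p \<in> W" for p using that W(1) by (simp add: x_def)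
  define y where "y = Max (snd ` W)"
  have y: "snd p \<le> y" if "p \<in> W" for p using that W(1) by (simp add: y_def)
  define d where "d = (x + 1, y + 1)"
  have d: "fst p < fst d" "snd p < snd d" if "p \<in> W" for p
    using x[OF that] y[OF that] by (simp_all add: d_def)
  have "d \<notin> W" using d(1)[of d] by auto
  have "fst d \<notin> fst ` W" "snd d \<notin> snd ` W" using d by (metis imageE less_irrefl)+
  have "finite (insert d W)" "inj_on fst (insert d W)" "inj_on snd (insert d W)" "even (card (insert d W))"
    using W False \<open>d \<notin> W\<close> \<open>fst d \<notin> fst ` W\<close> \<open>snd d \<notin> snd ` W\<close>
    by (simp_all add: inj_on_insert)
  from balanced_halves_even[OF this] obtain R' where R': "R' \<subseteq> insert d W"
    "\<forall>a b c. card ((insert d W - R') \<inter> {a..b} \<times> {..c}) \<le> card (R' \<inter> {a..b} \<times> {..c}) + 2 \<and>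
      card (R' \<inter> {a..b} \<times> {c..}) \<le> card ((insert d W - R') \<inter> {a..b} \<times> {c..}) + 2" by metis
  define R where "R = R' - {d}"
  have RW: "R \<subseteq> W" using R'(1) unfolding R_def by blast
  have clip: "A \<inter> {a..min b x} \<times> S = (A \<inter> W) \<inter> {a..b} \<times> S" if "A \<subseteq> insert d W" for A a b and S :: "real set"
  proof -
    have "d \<notin> {a..min b x} \<times> S" by (simp add: d_def)
    moreover have "p \<in> {a..min b x} \<times> S \<longleftrightarrow> p \<in> {a..b} \<times> S" if "p \<in> W" for p
      using x[OF that] by (auto simp: mem_Times_iff)
    ultimately show ?thesis using that by blast
  qed
  have "R' \<inter> W = R" "(insert d W - R') \<inter> W = W - R" using RW \<open>d \<notin> W\<close> unfolding R_def by blast+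
  then have eq: "R' \<inter> {a..min b x} \<times> S = R \<inter> {a..b} \<times> S"
    "(insert d W - R') \<inter> {a..min b x} \<times> S = (W - R) \<inter> {a..b} \<times> S" for a b S
    using clip[OF R'(1)] clip[of "insert d W - R'"] by auto
  have "card ((W - R) \<inter> {a..b} \<times> {..c}) \<le> card (R \<inter> {a..b} \<times> {..c}) + 2 \<and>
      card (R \<inter> {a..b} \<times> {c..}) \<le> card ((W - R) \<inter> {a..b} \<times> {c..}) + 2" for a b c
    using R'(2)[rule_format, of a "min b x" c] unfolding eq .
  then show ?thesis using RW by (intro exI[of _ R]) simp
qed

text \<open>At most \<open>card (R \<inter> B) + 2\<close> points of a bottomless range \<open>B\<close> lie outside \<open>R\<close>. If \<open>B\<close> has
  \<open>6 * k - 3 = 2 * (3 * k - 2) + 1\<close> points, this leaves at least \<open>3 * k - 5 / 2\<close> points in \<open>R\<close>, that is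
  \<open>3 * k - 2\<close> by integrality. For topless ranges the roles of \<open>R\<close> and its complement are exchanged.\<close>

lemma bottomless_topless_coloring:
  assumes V: "finite V" "general_position V" and k: "0 < k"
  shows "\<exists>c. polychromatic_coloring k
    (range_hypergraph V (bottomless_rectangles \<union> topless_rectangles) (6 * k - 3)) c"
proof -
  note inj = general_position_inj[OF V(2)]
  obtain R where R: "R \<subseteq> V"
    "\<forall>a b c. card ((V - R) \<inter> {a..b} \<times> {..c}) \<le> card (R \<inter> {a..b} \<times> {..c}) + 2 \<and>
      card (R \<inter> {a..b} \<times> {c..}) \<le> card ((V - R) \<inter> {a..b} \<times> {c..}) + 2"
    using balanced_halves[OF V(1) inj] by blast
  have sub: "finite U" "inj_on fst U" "inj_on snd U" if "U \<subseteq> V" for U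
    using that V(1) inj by (auto intro: finite_subset inj_on_subset)
  obtain h where h: "h ` R \<subseteq> {1..k}"
    "\<forall>a b c. 3 * k - 2 \<le> card (R \<inter> {a..b} \<times> {..c}) \<longrightarrow> {1..k} \<subseteq> h ` (R \<inter> {a..b} \<times> {..c})"
    using bottomless_coloring[OF sub[OF R(1)] k] by metis
  obtain g where g: "g ` (V - R) \<subseteq> {1..k}"
    "\<forall>a b c. 3 * k - 2 \<le> card ((V - R) \<inter> {a..b} \<times> {c..}) \<longrightarrow> {1..k} \<subseteq> g ` ((V - R) \<inter> {a..b} \<times> {c..})"
    using topless_coloring[OF sub[OF Diff_subset] k] by metis
  let ?f = "\<lambda>p. if p \<in> R then h p else g p"
  have f_eq: "?f ` (R \<inter> S) = h ` (R \<inter> S)" "?f ` ((V - R) \<inter> S) = g ` ((V - R) \<inter> S)" for S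
    by (auto intro!: image_cong)
  have half: "card (V \<inter> S) = card (R \<inter> S) + card ((V - R) \<inter> S)" for S
  proof -
    have "V \<inter> S = (R \<inter> S) \<union> ((V - R) \<inter> S)" using R(1) by blast
    then show ?thesis using card_Un_disjoint[of "R \<inter> S" "(V - R) \<inter> S"] sub[OF R(1)] V(1) by auto
  qed
  have "\<exists>v\<in>e. ?f v = i"
    if e: "e \<in> snd (range_hypergraph V (bottomless_rectangles \<union> topless_rectangles) (6 * k - 3))"
      and i: "i \<in> {1..k}" for e i
  proof -
    have ce: "card e = 6 * k - 3" using e by (simp add: range_hypergraph_def)
    from e obtain a b c where "e = V \<inter> {a..b} \<times> {..c} \<or> e = V \<inter> {a..b} \<times> {c..}"
      unfolding range_hypergraph_def bottomless_rectangles_def topless_rectangles_def by auto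
    then have "i \<in> ?f ` e"
    proof
      assume eB: "e = V \<inter> {a..b} \<times> {..c}"
      have "card ((V - R) \<inter> {a..b} \<times> {..c}) \<le> card (R \<inter> {a..b} \<times> {..c}) + 2" using R(2) by blast
      then have "3 * k - 2 \<le> card (R \<inter> {a..b} \<times> {..c})"
        using ce half[of "{a..b} \<times> {..c}"] k unfolding eB by linarith
      then have "{1..k} \<subseteq> h ` (R \<inter> {a..b} \<times> {..c})" using h(2) by blast
      moreover have "?f ` (R \<inter> {a..b} \<times> {..c}) \<subseteq> ?f ` e" unfolding eB using R(1) by (intro image_mono) blast
      ultimately show ?thesis using i unfolding f_eq by blast
    next
      assume eT: "e = V \<inter> {a..b} \<times> {c..}"
      have "card (R \<inter> {a..b} \<times> {c..}) \<le> card ((V - R) \<inter> {a..b} \<times> {c..}) + 2" using R(2) by blast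
      then have "3 * k - 2 \<le> card ((V - R) \<inter> {a..b} \<times> {c..})"
        using ce half[of "{a..b} \<times> {c..}"] k unfolding eT by linarith
      then have "{1..k} \<subseteq> g ` ((V - R) \<inter> {a..b} \<times> {c..})" using g(2) by blast
      moreover have "?f ` ((V - R) \<inter> {a..b} \<times> {c..}) \<subseteq> ?f ` e" unfolding eT by (intro image_mono) blast
      ultimately show ?thesis using i unfolding f_eq by blast
    qed
    then obtain v where "v \<in> e" "i = ?f v" by (rule imageE)
    then show ?thesis by (intro bexI[of _ v]) simp_all
  qed
  moreover have "?f ` V \<subseteq> {1..k}" using h(1) g(1) by (simp add: image_subset_iff)
  ultimately show ?thesis
    unfolding polychromatic_coloring_def by (intro exI[of _ ?f]) (simp add: range_hypergraph_def)
qed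

section \<open>Polychromatic numbers\<close>

text \<open>Hyperedges have exactly \<open>m\<close> points. A range with more points contains one with exactly \<open>m\<close> points,
  obtained by moving its right side to the left.\<close>

lemma shrink_range:
  fixes U :: "point set"
  assumes U: "finite U" "inj_on fst U" and m: "0 < m" "m \<le> card (U \<inter> {a..b} \<times> S)"
  shows "\<exists>b' \<le> b. card (U \<inter> {a..b'} \<times> S) = m"
proof -
  let ?A = "U \<inter> {a..b} \<times> S"
  let ?L = "lowest fst m ?A"
  have A: "finite ?A" "inj_on fst ?A" using U by (auto intro: inj_on_subset)
  have "?L \<subseteq> ?A" by (rule lowest_subset)
  moreover have "card ?L = m" using card_lowest[OF A, of m] m(2) by simp
  ultimately have L: "card ?L = m" "?L \<subseteq> ?A" "finite ?L" using A(1) finite_subset by blast+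
  then have "?L \<noteq> {}" using m(1) by auto
  then have "Max (fst ` ?L) \<in> fst ` ?L" using L(3) by simp
  then obtain q where q: "Max (fst ` ?L) = fst q" "q \<in> ?L" by (rule imageE)
  have max: "fst p \<le> fst q" if "p \<in> ?L" for p using that L(3) unfolding q(1)[symmetric] by simp
  have qb: "fst q \<le> b" using subsetD[OF L(2) q(2)] by (simp add: mem_Times_iff)
  have "U \<inter> {a..fst q} \<times> S = ?L"
  proof
    show "?L \<subseteq> U \<inter> {a..fst q} \<times> S"
    proof
      fix p assume p: "p \<in> ?L"
      then show "p \<in> U \<inter> {a..fst q} \<times> S" using subsetD[OF L(2) p] max[OF p] by (simp add: mem_Times_iff)
    qed
    show "U \<inter> {a..fst q} \<times> S \<subseteq> ?L"
    proof
      fix p assume p: "p \<in> U \<inter> {a..fst q} \<times> S"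
      then have "p \<in> ?A" "fst p \<le> fst q" using qb by (simp_all add: mem_Times_iff)
      then show "p \<in> ?L" using lower_part_lowest[OF A(1)] q(2) unfolding lower_part_def by blast
    qed
  qed
  then show ?thesis using qb L(1) by (intro exI[of _ "fst q"]) simp
qed

text \<open>Of the \<open>2 * m - 1\<close> points of a rectangle at least \<open>m\<close> lie in the same strip, and colourings of
  different strips do not interfere.\<close>

lemma unit_height_coloring:
  assumes m: "0 < m"
    and bltl: "\<And>V. finite V \<Longrightarrow> general_position V \<Longrightarrow>
      \<exists>c. polychromatic_coloring k (range_hypergraph V (bottomless_rectangles \<union> topless_rectangles) m) c"
    and V: "finite V" "general_position V"
  shows "\<exists>c. polychromatic_coloring k (range_hypergraph V unit_height_rectangles (2 * m - 1)) c"
proof -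
  have strip: "finite (unit_strip V i)" "general_position (unit_strip V i)" for i
    using finite_subset[OF unit_strip_subset V(1)] general_position_subset[OF V(2) unit_strip_subset] by simp_all
  obtain f where f: "\<And>i. polychromatic_coloring k
      (range_hypergraph (unit_strip V i) (bottomless_rectangles \<union> topless_rectangles) m) (f i)"
    using bltl[OF strip] by metis
  let ?f = "\<lambda>p. f \<lfloor>snd p\<rfloor> p"
  have f_strip: "?f p = f i p" if "p \<in> unit_strip V i" for p i using that by (simp add: unit_strip_def)
  have "?f p \<in> {1..k}" if "p \<in> V" for p
  proof -
    have "p \<in> unit_strip V \<lfloor>snd p\<rfloor>" using that by (simp add: unit_strip_def)
    then show ?thesis using f[of "\<lfloor>snd p\<rfloor>"] by (auto simp: polychromatic_coloring_def range_hypergraph_def)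
  qed
  moreover have colors: "\<exists>v\<in>unit_strip V i \<inter> {a..b} \<times> S. ?f v = j"
    if S: "S = {..c} \<or> S = {c..}" and big: "m \<le> card (unit_strip V i \<inter> {a..b} \<times> S)" and j: "j \<in> {1..k}"
    for i j a b c S
  proof -
    obtain b' where b': "b' \<le> b" "card (unit_strip V i \<inter> {a..b'} \<times> S) = m"
      using shrink_range[OF strip(1) general_position_inj(1)[OF strip(2)] m big] by blast
    have "{a..b'} \<times> S \<in> bottomless_rectangles \<union> topless_rectangles"
      using S unfolding bottomless_rectangles_def topless_rectangles_def by blast
    then have "unit_strip V i \<inter> {a..b'} \<times> S
        \<in> snd (range_hypergraph (unit_strip V i) (bottomless_rectangles \<union> topless_rectangles) m)"
      using b'(2) unfolding range_hypergraph_def by auto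
    then obtain v where v: "v \<in> unit_strip V i \<inter> {a..b'} \<times> S" "f i v = j"
      using f[of i] j unfolding polychromatic_coloring_def by blast
    have "v \<in> unit_strip V i \<inter> {a..b} \<times> S" using v(1) b'(1) by (auto simp: mem_Times_iff)
    moreover have "?f v = j" using v f_strip[of v i] by simp
    ultimately show ?thesis by blast
  qed
  moreover have "\<exists>v\<in>e. ?f v = j"
    if e: "e \<in> snd (range_hypergraph V unit_height_rectangles (2 * m - 1))" and j: "j \<in> {1..k}" for e j
  proof -
    obtain a b c where ce: "card e = 2 * m - 1" and e: "e = V \<inter> {a..b} \<times> {c..c + 1}"
      using e unfolding range_hypergraph_def unit_height_rectangles_def by auto
    have "m \<le> card (unit_strip V \<lfloor>c\<rfloor> \<inter> {a..b} \<times> {c..})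
        \<or> m \<le> card (unit_strip V (\<lfloor>c\<rfloor> + 1) \<inter> {a..b} \<times> {..c + 1})"
      using ce card_unit_height_split[OF V(1), of a b c] m unfolding e by linarith
    then show ?thesis
    proof
      assume "m \<le> card (unit_strip V \<lfloor>c\<rfloor> \<inter> {a..b} \<times> {c..})"
      from colors[OF _ this j] show ?thesis unfolding e unit_height_split by blast
    next
      assume "m \<le> card (unit_strip V (\<lfloor>c\<rfloor> + 1) \<inter> {a..b} \<times> {..c + 1})"
      from colors[OF _ this j] show ?thesis unfolding e unit_height_split by blast
    qed
  qed
  ultimately show ?thesis
    unfolding polychromatic_coloring_def
    by (intro exI[of _ ?f]) (simp add: range_hypergraph_def image_subset_iff)
qed

lemma polychromatic_number_le:
  assumes "0 < m" "\<And>V. finite V \<Longrightarrow> general_position V \<Longrightarrow> \<exists>c. polychromatic_coloring k (range_hypergraph V \<R> m) c"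
  shows "polychromatic_number \<R> k \<le> enat m"
  unfolding polychromatic_number_def using assms by (intro Inf_lower) blast

lemma polychromatic_number_attained:
  assumes "polychromatic_number \<R> k \<noteq> \<infinity>"
  obtains m where "polychromatic_number \<R> k = enat m" "0 < m"
    "\<And>V. finite V \<Longrightarrow> general_position V \<Longrightarrow> \<exists>c. polychromatic_coloring k (range_hypergraph V \<R> m) c"
proof -
  define A where "A = {enat m | m. 0 < m \<and> (\<forall>V. finite V \<and> general_position V \<longrightarrow>
    (\<exists>c. polychromatic_coloring k (range_hypergraph V \<R> m) c))}"
  have Inf: "polychromatic_number \<R> k = Inf A" unfolding polychromatic_number_def A_def ..
  have "A \<noteq> {}" using assms unfolding Inf by (auto simp: Inf_enat_def)
  then have "Inf A = (LEAST x. x \<in> A)" "\<exists>x. x \<in> A" by (auto simp: Inf_enat_def)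
  then have "Inf A \<in> A" using LeastI_ex[of "\<lambda>x. x \<in> A"] by simp
  then obtain m where "Inf A = enat m" "0 < m"
    "\<forall>V. finite V \<and> general_position V \<longrightarrow> (\<exists>c. polychromatic_coloring k (range_hypergraph V \<R> m) c)"
    unfolding A_def by blast
  then show thesis using that[of m] unfolding Inf by blast
qed

theorem theorem26:
  shows "(\<forall>m::nat. 0 < m \<longrightarrow>
            (\<forall>V. finite V \<and> general_position V \<longrightarrow>
               (\<exists>X. shallow_hitting_set 63 (range_hypergraph V unit_height_rectangles m) X)))
       \<and> (\<forall>k::nat. 0 < k \<longrightarrow>
            polychromatic_number unit_height_rectangles k
              \<le> 2 * polychromatic_number (bottomless_rectangles \<union> topless_rectangles) k - 1
            \<and> 2 * polychromatic_number (bottomless_rectangles \<union> topless_rectangles) k - 1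
              \<le> enat (12 * k - 7))"
proof (intro conjI allI impI)
  fix m :: nat and V
  assume "0 < m" "finite V \<and> general_position V"
  then show "\<exists>X. shallow_hitting_set 63 (range_hypergraph V unit_height_rectangles m) X"
    using unit_height_shallow by blast
next
  fix k :: nat assume k: "0 < k"
  let ?n = "polychromatic_number (bottomless_rectangles \<union> topless_rectangles) k"
  have le: "?n \<le> enat (6 * k - 3)"
    using k bottomless_topless_coloring[OF _ _ k] by (intro polychromatic_number_le) auto
  have "?n \<noteq> \<infinity>"
  proof
    assume "?n = \<infinity>"
    then show False using le by simp
  qed
  then obtain m where m: "?n = enat m" "0 < m"
    "\<And>V. finite V \<Longrightarrow> general_position V \<Longrightarrow>
      \<exists>c. polychromatic_coloring k (range_hypergraph V (bottomless_rectangles \<union> topless_rectangles) m) c"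
    by (rule polychromatic_number_attained) blast
  have eq: "2 * ?n - 1 = enat (2 * m - 1)"
    by (simp add: m(1) numeral_eq_enat one_enat_def)
  show "polychromatic_number unit_height_rectangles k \<le> 2 * ?n - 1"
    unfolding eq using m(2,3) by (intro polychromatic_number_le unit_height_coloring[of m]) auto
  have "m \<le> 6 * k - 3" using le m(1) by simp
  then show "2 * ?n - 1 \<le> enat (12 * k - 7)"
    unfolding eq using k by simp
qed

end
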